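(* Assume the Riemann hypothesis. Let $C>(2\log 2)^{-1}$ be fixed. Then for every sufficiently large $T$, setting $m=\lfloor C\log T\,\log\log T\rfloor$, there exists $k\in\{1,3,5,\ldots,2m-1,2m\}$ (i.e. $k$ is an odd integer with $1\le k\le 2m-1$, or $k=2m$) such that $$\max_{t\in[T-2\pi,T+2\pi]}|Z^{(k)}(t)|\;\ge\;\Big(1-\frac{\log\log\log T}{\log\log T}\Big)^k\Big(\log\sqrt{\tfrac{T}{2\pi}}\Big)^k\,|Z(T)|.$$
   Context: $Z$ denotes Hardy's function, the real-valued smooth function on $\mathbb{R}$ given by $Z(t)=e^{i\theta(t)}\zeta(\tfrac12+it)$, where $\zeta$ is the Riemann zeta function and $\theta(t)=\arg\big(\pi^{-it/2}\Gamma(\tfrac14+\tfrac{it}{2})\big)$ is the Riemann-Siegel theta function (continuous argument with $\theta(0)=0$). Its real zeros are the ordinates of the zeros of $\zeta$ on the line of real part $\tfrac12$. $Z^{(k)}$ is the $k$-th derivative and $\lfloor\cdot\rfloor$ is the floor function. *)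

theory Defs
  imports "HOL-Complex_Analysis.Complex_Analysis"
begin

text \<open>
  The Riemann zeta function is the unique analytic continuation of the Dirichlet series to
  the plane without \<open>1\<close>; the value at the pole is set to \<open>0\<close> so that the description is
  unique. Existence and uniqueness are proved in \<open>zeta_continuation_ex1\<close>.
\<close>

definition zeta :: "complex \<Rightarrow> complex" where
  "zeta = (THE f. f holomorphic_on - {1} \<and>
                  (\<forall>s. Re s > 1 \<longrightarrow> f s = (\<Sum>n. 1 / of_nat (Suc n) powr s)) \<and> f 1 = 0)"

lemma zeta_series_summable:
  fixes s :: complex
  assumes "Re s > 1"
  shows "summable (\<lambda>n. 1 / of_nat (Suc n) powr s)"
proof (rule summable_norm_cancel)
  have "summable (\<lambda>n. real n powr - Re s)"
    using assms by (simp add: summable_real_powr_iff)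
  then have "summable (\<lambda>n. real (Suc n) powr - Re s)"
    by (subst summable_Suc_iff)
  also have "(\<lambda>n. real (Suc n) powr - Re s) = (\<lambda>n. norm (1 / of_nat (Suc n) powr s))"
    by (intro ext) (simp add: norm_divide norm_powr_real_powr powr_minus_divide del: of_nat_Suc)
  finally show "summable (\<lambda>n. norm (1 / of_nat (Suc n) powr s))" .
qed

lemma holomorphic_gbinomial: "(\<lambda>s. (1 - s :: complex) gchoose k) holomorphic_on A"
  unfolding gbinomial_prod_rev by (intro holomorphic_intros) auto

text \<open>
  Existence of the continuation. Summing \<open>(n+1) powr (1-s) - n powr (1-s)\<close>, expanded by the
  binomial theorem up to order \<open>K\<close> in \<open>1/n\<close>, expresses \<open>(s-1) * zeta s\<close> by its values at
  \<open>s+1, \<dots>, s+K-1\<close> and a series that converges for \<open>Re s > 1 - K\<close>. Induction on \<open>K\<close>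
  continues it one unit to the left at a time.
\<close>

lemma gbinomial_Suc_mult:
  fixes a :: complex
  shows "of_nat (Suc k) * (a gchoose Suc k) = (a - of_nat k) * (a gchoose k)"
  using gbinomial_mult_1[of a k] by (simp add: left_diff_distrib)

lemma zeta_remainder_bound:
  fixes s :: complex
  assumes s: "Re s + real K \<ge> 0"
  shows "cmod (of_nat (Suc (Suc n)) powr (1 - s)
            - (\<Sum>j\<le>K. ((1 - s) gchoose j) * of_nat (Suc n) powr (1 - s - of_nat j)))
         \<le> real (Suc K) * cmod ((1 - s) gchoose Suc K) * real (Suc n) powr (- Re s - real K)"
proof -
  define f where "f = (\<lambda>j x. fact j * ((1 - s) gchoose j) * x powr (1 - s - of_nat j))"
  define S where "S = complex_of_real ` {real (Suc n)..real (Suc (Suc n))}"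
  define B where "B = fact (Suc K) * cmod ((1 - s) gchoose Suc K) * real (Suc n) powr (- Re s - real K)"
  have step: "fact (Suc j) * ((1 - s) gchoose Suc j) = fact j * ((1 - s) gchoose j) * (1 - s - of_nat j)" for j
    using gbinomial_Suc_mult[of j "1 - s"] by (simp add: mult_ac del: of_nat_Suc)
  have conv: "convex S" unfolding S_def
    by (intro convex_linear_image convex_real_interval) (auto intro!: bounded_linear.linear bounded_linear_of_real)
  have "cmod (f 0 (of_nat (Suc (Suc n))) - (\<Sum>i\<le>K. f i (of_nat (Suc n)) * (of_nat (Suc (Suc n)) - of_nat (Suc n)) ^ i / fact i))
       \<le> B * cmod (of_nat (Suc (Suc n)) - of_nat (Suc n)) ^ Suc K / fact K"
  proof (rule complex_Taylor[OF conv])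
    fix i x assume x: "x \<in> S" "i \<le> K"
    then have "x \<notin> \<real>\<^sub>\<le>\<^sub>0" by (auto simp: S_def complex_nonpos_Reals_iff)
    then have "((\<lambda>x. x powr (1 - s - of_nat i)) has_field_derivative
        (1 - s - of_nat i) * x powr (1 - s - of_nat i - 1)) (at x within S)"
      by (intro has_field_derivative_at_within[OF has_field_derivative_powr])
    then have "((\<lambda>x. fact i * ((1 - s) gchoose i) * x powr (1 - s - of_nat i)) has_field_derivative
        fact i * ((1 - s) gchoose i) * ((1 - s - of_nat i) * x powr (1 - s - of_nat i - 1))) (at x within S)"
      by (rule DERIV_cmult)
    moreover have "1 - s - of_nat i - 1 = 1 - s - of_nat (Suc i)" by simp
    ultimately show "(f i has_field_derivative f (Suc i) x) (at x within S)"
      unfolding f_def step by (simp only: mult.assoc)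
  next
    fix x assume "x \<in> S"
    then obtain y where y: "x = of_real y" "y \<ge> real (Suc n)" by (auto simp: S_def)
    have "cmod (x powr (1 - s - of_nat (Suc K))) = y powr (- Re s - real K)"
      using y by (subst norm_powr_real_powr) auto
    also have "\<dots> \<le> real (Suc n) powr (- Re s - real K)"
      using y s by (intro powr_mono2') auto
    finally show "cmod (f (Suc K) x) \<le> B"
      unfolding f_def B_def norm_mult norm_fact by (intro mult_left_mono) auto
  next
    show "of_nat (Suc n) \<in> S"
      unfolding S_def by (rule image_eqI[of _ _ "real (Suc n)"]) auto
    show "of_nat (Suc (Suc n)) \<in> S"
      unfolding S_def by (rule image_eqI[of _ _ "real (Suc (Suc n))"]) auto
  qed
  moreover have "of_nat (Suc (Suc n)) - of_nat (Suc n) = (1 :: complex)" by simp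
  moreover have "f i (of_nat (Suc n)) * 1 ^ i / fact i
      = ((1 - s) gchoose i) * of_nat (Suc n) powr (1 - s - of_nat i)" for i
    by (simp add: f_def del: of_nat_Suc)
  moreover have "B * cmod 1 ^ Suc K / fact K
      = real (Suc K) * cmod ((1 - s) gchoose Suc K) * real (Suc n) powr (- Re s - real K)"
    by (simp add: B_def del: of_nat_Suc)
  moreover have "f 0 (of_nat (Suc (Suc n))) = of_nat (Suc (Suc n)) powr (1 - s)"
    by (simp add: f_def del: of_nat_Suc)
  ultimately show ?thesis by (simp only:)
qed

lemma zeta_remainder_holomorphic:
  obtains R where "R holomorphic_on {s. Re s > 1 - real K}"
    "\<And>s. Re s > 1 - real K \<Longrightarrow> (\<lambda>n. of_nat (Suc (Suc n)) powr (1 - s)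
            - (\<Sum>j\<le>K. ((1 - s) gchoose j) * of_nat (Suc n) powr (1 - s - of_nat j))) sums R s"
proof -
  define S where "S = {s. Re s > 1 - real K}"
  have opS: "open S" unfolding S_def by (rule open_halfspace_Re_gt)
  define r :: "nat \<Rightarrow> complex \<Rightarrow> complex" where "r = (\<lambda>n s. of_nat (Suc (Suc n)) powr (1 - s)
            - (\<Sum>j\<le>K. ((1 - s) gchoose j) * of_nat (Suc n) powr (1 - s - of_nat j)))"
  have hol: "r n holomorphic_on S" for n
    unfolding r_def by (intro holomorphic_intros holomorphic_gbinomial) (auto simp del: of_nat_Suc)
  obtain R where R: "\<forall>x\<in>S. (\<lambda>n. r n x) sums R x \<and> R field_differentiable at x"
  proof (rule series_differentiable_comparison_complex[OF opS, of r])
    show "r n field_differentiable at x" if "x \<in> S" for n x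
      using hol opS that by (metis holomorphic_on_open field_differentiable_def)
  next
    fix x assume x: "x \<in> S"
    define d where "d = (Re x - (1 - real K)) / 2"
    have d: "d > 0" using x by (auto simp: d_def S_def)
    have "compact ((\<lambda>s. (1 - s :: complex) gchoose Suc K) ` cball x d)"
      by (intro compact_continuous_image holomorphic_on_imp_continuous_on holomorphic_gbinomial) auto
    then have "bounded ((\<lambda>s. (1 - s :: complex) gchoose Suc K) ` cball x d)"
      by (rule compact_imp_bounded)
    then obtain M where M: "\<And>y. y \<in> cball x d \<Longrightarrow> cmod ((1 - y) gchoose Suc K) \<le> M"
      unfolding bounded_iff by blast
    have M0: "M \<ge> 0" using M[of x] d norm_ge_zero order_trans by (metis centre_in_cball less_imp_le)
    define h where "h = (\<lambda>n. real (Suc K) * M * real (Suc n) powr (- 1 - d))"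
    have h0: "h n \<ge> 0" for n using M0 by (simp add: h_def)
    have "summable (\<lambda>n. real n powr (- 1 - d))" using d by (simp add: summable_real_powr_iff)
    then have "summable (\<lambda>n. real (Suc n) powr (- 1 - d))" by (subst summable_Suc_iff)
    then have sh: "summable h" unfolding h_def by (intro summable_mult)
    have "cmod (r n y) \<le> h n" if y: "y \<in> ball x d" for n y
    proof -
      have "\<bar>Re (x - y)\<bar> < d" using y abs_Re_le_cmod[of "x - y"] by (simp add: dist_norm)
      then have Re: "Re y + real K \<ge> 1 + d" by (simp add: d_def abs_if field_simps split: if_splits)
      have "cmod (r n y) \<le> real (Suc K) * cmod ((1 - y) gchoose Suc K) * real (Suc n) powr (- Re y - real K)"
        unfolding r_def using Re d by (intro zeta_remainder_bound) auto
      also have "\<dots> \<le> h n" unfolding h_def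
        using y M0 Re by (intro mult_mono M powr_mono) auto
      finally show ?thesis .
    qed
    then show "\<exists>d h. 0 < d \<and> summable h \<and> range h \<subseteq> \<real>\<^sub>\<ge>\<^sub>0 \<and>
       (\<forall>\<^sub>F n in sequentially. \<forall>y\<in>ball x d \<inter> S. cmod (r n y) \<le> cmod (h n))"
      using d sh h0 
      by (intro exI[of _ d] exI[of _ "\<lambda>n. complex_of_real (h n)"])
         (auto simp: summable_of_real nonneg_Reals_of_real_iff abs_of_nonneg)
  qed
  show ?thesis
    by (rule that[of R]) (use R in \<open>auto simp: S_def r_def holomorphic_on_def intro: field_differentiable_at_within\<close>)
qed


lemma zeta_series_recurrence:
  fixes s :: complex
  defines "D \<equiv> \<lambda>s. \<Sum>n. 1 / (of_nat (Suc n) powr s :: complex)"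
  assumes s: "Re s > 1" and K: "K \<ge> 1"
  assumes R: "(\<lambda>n. of_nat (Suc (Suc n)) powr (1 - s)
            - (\<Sum>j\<le>K. ((1 - s) gchoose j) * of_nat (Suc n) powr (1 - s - of_nat j))) sums R"
  shows "(s - 1) * D s = 1 + R - (\<Sum>j=2..K. ((1 - s) gchoose (j - 1)) / of_nat j * ((s + of_nat j - 1 - 1) * D (s + of_nat j - 1)))"
proof -
  have lim: "(\<lambda>n. complex_of_nat (Suc n) powr (1 - s)) \<longlonglongrightarrow> 0"
  proof (rule tendsto_norm_zero_cancel)
    have "(\<lambda>n. real n powr (1 - Re s)) \<longlonglongrightarrow> 0"
      using s by (intro tendsto_neg_powr filterlim_real_sequentially) auto
    then have "(\<lambda>n. real (Suc n) powr (1 - Re s)) \<longlonglongrightarrow> 0"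
      by (rule LIMSEQ_Suc)
    also have "(\<lambda>n. real (Suc n) powr (1 - Re s)) = (\<lambda>n. norm (complex_of_nat (Suc n) powr (1 - s)))"
      by (intro ext) (simp add: norm_powr_real_powr del: of_nat_Suc)
    finally show "(\<lambda>n. norm (complex_of_nat (Suc n) powr (1 - s))) \<longlonglongrightarrow> 0" .
  qed
  have tele: "(\<lambda>n. complex_of_nat (Suc (Suc n)) powr (1 - s) - of_nat (Suc n) powr (1 - s)) sums (0 - 1)"
    using telescope_sums[OF lim] by simp
  have Dsum: "(\<lambda>n. of_nat (Suc n) powr (1 - s - of_nat j)) sums D (s + of_nat j - 1)" if "j \<in> {1..K}" for j
  proof -
    have "(\<lambda>n. 1 / of_nat (Suc n) powr (s + of_nat j - 1)) sums D (s + of_nat j - 1)"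
      unfolding D_def using s that by (intro summable_sums zeta_series_summable) auto
    moreover have "1 / of_nat (Suc n) powr (s + of_nat j - 1) = of_nat (Suc n) powr (1 - s - of_nat j)" for n
    proof -
      have eq: "1 - s - of_nat j = - (s + of_nat j - 1)" by simp
      show ?thesis unfolding eq powr_minus_divide ..
    qed
    ultimately show ?thesis by (simp only:)
  qed
  have "(\<lambda>n. (of_nat (Suc (Suc n)) powr (1 - s) - of_nat (Suc n) powr (1 - s))
           - (\<Sum>j=1..K. ((1 - s) gchoose j) * of_nat (Suc n) powr (1 - s - of_nat j)))
        sums ((0 - 1) - (\<Sum>j=1..K. ((1 - s) gchoose j) * D (s + of_nat j - 1)))"
    by (intro sums_diff tele sums_sum sums_mult Dsum)
  also have "(\<lambda>n. (of_nat (Suc (Suc n)) powr (1 - s) - of_nat (Suc n) powr (1 - s))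
           - (\<Sum>j=1..K. ((1 - s) gchoose j) * of_nat (Suc n) powr (1 - s - of_nat j)))
       = (\<lambda>n. of_nat (Suc (Suc n)) powr (1 - s)
            - (\<Sum>j\<le>K. ((1 - s) gchoose j) * of_nat (Suc n) powr (1 - s - of_nat j)))"
    by (simp add: atMost_atLeast0 sum.atLeast_Suc_atMost algebra_simps)
  finally have "R = (0 - 1) - (\<Sum>j=1..K. ((1 - s) gchoose j) * D (s + of_nat j - 1))"
    using R sums_unique2 by blast
  also have "(\<Sum>j=1..K. ((1 - s) gchoose j) * D (s + of_nat j - 1))
     = (1 - s) * D s + (\<Sum>j=2..K. ((1 - s) gchoose j) * D (s + of_nat j - 1))"
    using K by (simp add: sum.atLeast_Suc_atMost numeral_2_eq_2)
  also have "(\<Sum>j=2..K. ((1 - s) gchoose j) * D (s + of_nat j - 1))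
     = - (\<Sum>j=2..K. ((1 - s) gchoose (j - 1)) / of_nat j * ((s + of_nat j - 1 - 1) * D (s + of_nat j - 1)))"
    unfolding sum_negf [symmetric]
  proof (intro sum.cong refl)
    fix j assume "j \<in> {2..K}"
    then obtain k where k: "j = Suc k" by (cases j) auto
    have "of_nat (Suc k) * ((1 - s) gchoose Suc k) = (1 - s - of_nat k) * ((1 - s) gchoose k)"
      by (rule gbinomial_Suc_mult)
    then have "((1 - s) gchoose Suc k) = (1 - s - of_nat k) * ((1 - s) gchoose k) / of_nat (Suc k)"
      by (simp add: eq_divide_eq mult.commute del: of_nat_Suc) 
    moreover have "(1 - s - of_nat k) = - (s + of_nat j - 1 - 1)" using k by simp
    ultimately show "((1 - s) gchoose j) * D (s + of_nat j - 1)
      = - (((1 - s) gchoose (j - 1)) / of_nat j * ((s + of_nat j - 1 - 1) * D (s + of_nat j - 1)))"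
      by (simp only: k diff_Suc_1 times_divide_eq_left times_divide_eq_right minus_divide_left
            mult_minus_left mult_minus_right mult_ac)
  qed
  finally show ?thesis by (simp add: algebra_simps)
qed

lemma zeta_continuation_halfplane:
  "\<exists>g. g holomorphic_on {s. Re s > 1 - real N} \<and>
       (\<forall>s. Re s > 1 \<longrightarrow> g s = (s - 1) * (\<Sum>n. 1 / of_nat (Suc n) powr s))"
proof (induction N)
  case 0
  obtain R where R: "R holomorphic_on {s. Re s > 1 - real 1}"
    "\<And>s. Re s > 1 - real 1 \<Longrightarrow> (\<lambda>n. of_nat (Suc (Suc n)) powr (1 - s)
            - (\<Sum>j\<le>1. ((1 - s) gchoose j) * of_nat (Suc n) powr (1 - s - of_nat j))) sums R s"
    using zeta_remainder_holomorphic[of 1] by blast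
  show ?case
  proof (intro exI[of _ "\<lambda>s. 1 + R s"] conjI allI impI)
    show "(\<lambda>s. 1 + R s) holomorphic_on {s. Re s > 1 - real 0}"
      by (intro holomorphic_intros holomorphic_on_subset[OF R(1)]) auto
    show "1 + R s = (s - 1) * (\<Sum>n. 1 / of_nat (Suc n) powr s)" if "Re s > 1" for s
      using zeta_series_recurrence[OF that _ R(2)] that by simp
  qed
next
  case (Suc N)
  then obtain g where g: "g holomorphic_on {s. Re s > 1 - real N}"
    "\<And>s. Re s > 1 \<Longrightarrow> g s = (s - 1) * (\<Sum>n. 1 / of_nat (Suc n) powr s)" by auto
  obtain R where R: "R holomorphic_on {s. Re s > 1 - real (Suc N)}"
    "\<And>s. Re s > 1 - real (Suc N) \<Longrightarrow> (\<lambda>n. of_nat (Suc (Suc n)) powr (1 - s)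
            - (\<Sum>j\<le>Suc N. ((1 - s) gchoose j) * of_nat (Suc n) powr (1 - s - of_nat j))) sums R s"
    using zeta_remainder_holomorphic[of "Suc N"] by blast
  define G where "G = (\<lambda>s. 1 + R s - (\<Sum>j=2..Suc N. ((1 - s) gchoose (j - 1)) / of_nat j * g (s + of_nat j - 1)))"
  show ?case
  proof (intro exI[of _ G] conjI allI impI)
    have "(\<lambda>s. g (s + of_nat j - 1)) holomorphic_on {s. Re s > 1 - real (Suc N)}" if "j \<in> {2..Suc N}" for j
      by (rule holomorphic_on_compose_gen[OF _ g(1), unfolded o_def])
         (use that in \<open>auto intro!: holomorphic_intros\<close>)
    then show "G holomorphic_on {s. Re s > 1 - real (Suc N)}"
      unfolding G_def by (intro holomorphic_intros holomorphic_gbinomial R(1)) auto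
    fix s :: complex assume s: "Re s > 1"
    have "(s - 1) * (\<Sum>n. 1 / of_nat (Suc n) powr s)
       = 1 + R s - (\<Sum>j=2..Suc N. ((1 - s) gchoose (j - 1)) / of_nat j *
          ((s + of_nat j - 1 - 1) * (\<Sum>n. 1 / of_nat (Suc n) powr (s + of_nat j - 1))))"
      using s by (intro zeta_series_recurrence R(2)) auto
    also have "\<dots> = G s"
      unfolding G_def using s
      by (intro arg_cong2[of _ _ _ _ "(-)"] refl sum.cong) (subst g(2), auto)
    finally show "G s = (s - 1) * (\<Sum>n. 1 / of_nat (Suc n) powr s)" ..
  qed
qed

lemma zeta_continuation_ex1:
  "\<exists>!f. f holomorphic_on - {1} \<and>
        (\<forall>s. Re s > 1 \<longrightarrow> f s = (\<Sum>n. 1 / of_nat (Suc n) powr s)) \<and> f (1 :: complex) = (0 :: complex)"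
proof (rule ex_ex1I)
  obtain g where g: "\<And>N. g N holomorphic_on {s. Re s > 1 - real N}"
    "\<And>N s. Re s > 1 \<Longrightarrow> g N s = (s - 1) * (\<Sum>n. 1 / of_nat (Suc n) powr s)"
    using zeta_continuation_halfplane by metis
  have agree: "g M s = g N s" if "M \<le> N" "Re s > 1 - real M" for M N s
  proof (rule analytic_continuation_open[of "{s. Re s > 1}" "{s. Re s > 1 - real M}" "g M" "g N"])
    show "connected {s. Re s > 1 - real M}"
      by (intro convex_connected convex_halfspace_Re_gt)
    show "g N holomorphic_on {s. Re s > 1 - real M}"
      using that by (intro holomorphic_on_subset[OF g(1)]) auto
    show "{s. Re s > 1} \<noteq> {}" by (auto intro!: exI[of _ "2 :: complex"])
  qed (use g that in \<open>auto simp: open_halfspace_Re_gt\<close>)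
  define N where "N = (\<lambda>s. nat \<lceil>2 - Re s\<rceil>)"
  define G where "G = (\<lambda>s. g (N s) s)"
  have G: "G s = g M s" if "Re s > 1 - real M" for M s
  proof -
    have "Re s > 1 - real (N s)" unfolding N_def by linarith
    then show ?thesis unfolding G_def using that agree by (metis nle_le)
  qed
  have Ghol: "G holomorphic_on UNIV"
  proof -
    have "G holomorphic_on (\<Union>M. {s. Re s > 1 - real M})"
    proof (rule holomorphic_on_UN_open)
      show "G holomorphic_on {s. Re s > 1 - real M}" for M
        using g(1)[of M] G by (subst holomorphic_cong[OF refl, of _ _ "g M"]) auto
    qed (auto simp: open_halfspace_Re_gt)
    moreover have "(\<Union>M. {s. Re s > 1 - real M}) = UNIV"
    proof (intro equalityI subsetI UNIV_I)
      fix s :: complex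
      obtain M :: nat where "real M > 1 - Re s" using reals_Archimedean2 by blast
      then show "s \<in> (\<Union>M. {s. Re s > 1 - real M})" by (auto intro!: exI[of _ M])
    qed
    ultimately show ?thesis by simp
  qed
  show "\<exists>f. f holomorphic_on - {1} \<and>
        (\<forall>s. Re s > 1 \<longrightarrow> f s = (\<Sum>n. 1 / of_nat (Suc n) powr s)) \<and> f (1 :: complex) = (0 :: complex)"
  proof (intro exI[of _ "\<lambda>s. G s / (s - 1)"] conjI allI impI)
    show "(\<lambda>s. G s / (s - 1)) holomorphic_on - {1}"
      by (intro holomorphic_intros holomorphic_on_subset[OF Ghol]) auto
    show "G s / (s - 1) = (\<Sum>n. 1 / of_nat (Suc n) powr s)" if "Re s > 1" for s
      using that G[of 0 s] g(2)[of s 0] by auto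
  qed auto
next
  fix f h :: "complex \<Rightarrow> complex"
  assume f: "f holomorphic_on - {1} \<and> (\<forall>s. Re s > 1 \<longrightarrow> f s = (\<Sum>n. 1 / of_nat (Suc n) powr s)) \<and> f 1 = 0"
    and h: "h holomorphic_on - {1} \<and> (\<forall>s. Re s > 1 \<longrightarrow> h s = (\<Sum>n. 1 / of_nat (Suc n) powr s)) \<and> h 1 = 0"
  show "f = h"
  proof
    fix s
    show "f s = h s"
    proof (cases "s = 1")
      case False
      show ?thesis
      proof (rule analytic_continuation_open[of "{s. Re s > 1}" "- {1}" f h])
        show "connected (- {1 :: complex})"
          by (rule connected_punctured_universe) simp
        show "{s. Re s > 1} \<noteq> {}" by (auto intro!: exI[of _ "2 :: complex"])
      qed (use f h False in \<open>auto simp: open_halfspace_Re_gt\<close>)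
    qed (use f h in simp)
  qed
qed

lemma
  shows zeta_holomorphic: "zeta holomorphic_on - {1}"
    and zeta_eq_series: "Re s > 1 \<Longrightarrow> zeta s = (\<Sum>n. 1 / of_nat (Suc n) powr s)"
    and zeta_1: "zeta 1 = 0"
  using theI'[OF zeta_continuation_ex1] unfolding zeta_def by blast+

text \<open>The zeros in the open critical strip are exactly the nontrivial zeros.\<close>

definition riemann_hypothesis :: bool where
  "riemann_hypothesis \<longleftrightarrow> (\<forall>s. zeta s = 0 \<and> 0 < Re s \<and> Re s < 1 \<longrightarrow> Re s = 1 / 2)"

definition riemann_siegel_theta_factor :: "real \<Rightarrow> complex" where
  "riemann_siegel_theta_factor t = of_real pi powr (- (\<i> * of_real t / 2)) * Gamma (1 / 4 + \<i> * of_real t / 2)"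

text \<open>
  The continuous branch of the argument of \<open>riemann_siegel_theta_factor\<close> that vanishes
  at \<open>0\<close>; see \<open>riemann_siegel_theta_ex1\<close>.
\<close>

definition riemann_siegel_theta :: "real \<Rightarrow> real" where
  "riemann_siegel_theta = (THE \<theta>. continuous_on UNIV \<theta> \<and> \<theta> 0 = 0 \<and>
     (\<forall>t. riemann_siegel_theta_factor t = of_real (cmod (riemann_siegel_theta_factor t)) * cis (\<theta> t)))"

lemma riemann_siegel_theta_ex1:
  "\<exists>!\<theta>. continuous_on UNIV \<theta> \<and> \<theta> 0 = 0 \<and>
     (\<forall>t. riemann_siegel_theta_factor t = of_real (cmod (riemann_siegel_theta_factor t)) * cis (\<theta> t))"
proof (rule ex_ex1I)
  define L where "L = (\<lambda>t. ln_Gamma (1 / 4 + \<i> * of_real t / 2) - \<i> * of_real (t / 2 * ln pi))"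
  have nz: "1 / 4 + \<i> * of_real t / 2 \<notin> \<real>\<^sub>\<le>\<^sub>0" for t
    by (auto simp: complex_nonpos_Reals_iff)
  have factor: "riemann_siegel_theta_factor t = exp (L t)" for t
  proof -
    have "Gamma (1 / 4 + \<i> * of_real t / 2) = exp (ln_Gamma (1 / 4 + \<i> * of_real t / 2))"
      using nz[of t] by (subst Gamma_complex_altdef) (auto dest: nonpos_Ints_subset_nonpos_Reals[THEN subsetD])
    moreover have "of_real pi powr (- (\<i> * of_real t / 2)) = exp (- (\<i> * of_real (t / 2 * ln pi)))"
      by (simp add: powr_def Ln_of_real mult_ac)
    ultimately show ?thesis
      unfolding riemann_siegel_theta_factor_def L_def by (simp only: mult_exp_exp) simp
  qed
  have contL: "continuous_on UNIV L"
    unfolding L_def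
    by (intro continuous_at_imp_continuous_on ballI continuous_intros isCont_ln_Gamma_complex nz) auto
  have "ln_Gamma (1 / 4 :: complex) = of_real (ln_Gamma (1 / 4))"
    using ln_Gamma_complex_of_real[of "1/4"] by simp
  then have "Im (L 0) = 0" by (simp add: L_def)
  moreover have "riemann_siegel_theta_factor t = of_real (cmod (riemann_siegel_theta_factor t)) * cis (Im (L t))" for t
    unfolding factor norm_exp_eq_Re by (rule exp_eq_polar)
  ultimately show "\<exists>\<theta>. continuous_on UNIV \<theta> \<and> \<theta> 0 = 0 \<and>
     (\<forall>t. riemann_siegel_theta_factor t = of_real (cmod (riemann_siegel_theta_factor t)) * cis (\<theta> t))"
    using contL by (intro exI[of _ "\<lambda>t. Im (L t)"] conjI allI continuous_on_Im)
next
  have nz: "riemann_siegel_theta_factor t \<noteq> 0" for t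
  proof -
    have "1 / 4 + \<i> * of_real t / 2 \<notin> \<real>\<^sub>\<le>\<^sub>0"
      by (auto simp: complex_nonpos_Reals_iff)
    then have "1 / 4 + \<i> * of_real t / 2 \<notin> \<int>\<^sub>\<le>\<^sub>0"
      using nonpos_Ints_subset_nonpos_Reals by blast
    then have "Gamma (1 / 4 + \<i> * of_real t / 2) \<noteq> 0" by (simp only: Gamma_eq_zero_iff not_False_eq_True)
    then show ?thesis by (simp add: riemann_siegel_theta_factor_def)
  qed
  fix \<theta> \<phi> :: "real \<Rightarrow> real"
  assume th: "continuous_on UNIV \<theta> \<and> \<theta> 0 = 0 \<and>
     (\<forall>t. riemann_siegel_theta_factor t = of_real (cmod (riemann_siegel_theta_factor t)) * cis (\<theta> t))"
    and ph: "continuous_on UNIV \<phi> \<and> \<phi> 0 = 0 \<and>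
     (\<forall>t. riemann_siegel_theta_factor t = of_real (cmod (riemann_siegel_theta_factor t)) * cis (\<phi> t))"
  define d where "d = (\<lambda>t. (\<theta> t - \<phi> t) / (2 * pi))"
  have dint: "d t \<in> \<int>" for t
  proof -
    have "of_real (cmod (riemann_siegel_theta_factor t)) * cis (\<theta> t) = of_real (cmod (riemann_siegel_theta_factor t)) * cis (\<phi> t)"
      using th ph by metis
    then have "cis (\<theta> t) = cis (\<phi> t)" using nz[of t] by simp
    then have "cis (\<theta> t - \<phi> t) = 1" by (simp flip: cis_divide)
    then have "cos (\<theta> t - \<phi> t) = 1" by (simp add: complex_eq_iff)
    then obtain n :: int where "\<theta> t - \<phi> t = of_int n * 2 * pi" using cos_one_2pi_int by blast
    then show ?thesis by (auto simp: d_def)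
  qed
  have "d constant_on UNIV"
  proof (rule continuous_discrete_range_constant)
    show "continuous_on UNIV d" unfolding d_def using th ph by (intro continuous_intros) auto
    show "\<exists>e>0. \<forall>y. y \<in> UNIV \<and> d y \<noteq> d x \<longrightarrow> e \<le> norm (d y - d x)" for x
    proof (intro exI[of _ 1] conjI allI impI)
      fix y assume "y \<in> UNIV \<and> d y \<noteq> d x"
      then show "1 \<le> norm (d y - d x)"
        using Ints_nonzero_abs_ge1[of "d y - d x"] dint by (auto intro: Ints_diff)
    qed simp
  qed auto
  then have "d t = d 0" for t unfolding constant_on_def by auto
  then show "\<theta> = \<phi>" using th ph by (intro ext) (simp add: d_def)
qed

lemma
  shows riemann_siegel_theta_continuous: "continuous_on UNIV riemann_siegel_theta"
    and riemann_siegel_theta_0: "riemann_siegel_theta 0 = 0"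
    and riemann_siegel_theta_polar: "riemann_siegel_theta_factor t = of_real (cmod (riemann_siegel_theta_factor t)) * cis (riemann_siegel_theta t)"
  using theI'[OF riemann_siegel_theta_ex1] unfolding riemann_siegel_theta_def by blast+

text \<open>
  The product is real by the functional equation of \<open>zeta\<close>, so \<open>Re\<close> only changes its type,
  which makes the iterated real derivative \<open>(deriv ^^ k) hardy_Z\<close> available.
\<close>

definition hardy_Z :: "real \<Rightarrow> real" where
  "hardy_Z t = Re (exp (\<i> * of_real (riemann_siegel_theta t)) * zeta (1 / 2 + \<i> * of_real t))"

end

theory Submission
  imports Defs "HOL-Real_Asymp.Real_Asymp"
begin

text \<open>
  By the functional equation, \<open>Z\<close> extends to a holomorphic function \<open>F\<close> on \<open>Re z > 0\<close>. Put
  \<open>L = ln (sqrt (T / (2 * pi)))\<close>, \<open>B = (1 - ln (ln (ln T)) / ln (ln T)) * L\<close>, \<open>M = \<bar>Z T\<bar>\<close>, and suppose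
  that near \<open>T\<close> the \<open>k\<close>-th derivative of \<open>Z\<close> is less than \<open>B ^ k * M\<close> for all odd \<open>k < 2 * m\<close>. Two
  applications of the mean value theorem bound all derivatives of order \<open>k < 2 * m\<close> at \<open>T\<close> by
  \<open>3 * B ^ k * M\<close>, so the Taylor expansion at \<open>T\<close> yields \<open>\<bar>F (T - \<i> * n)\<bar> \<le> 3 * M * exp (B * n) + O(1)\<close>
  for an integer \<open>n\<close> just above \<open>10 * ln (ln T) / ln (ln (ln T))\<close>: by Cauchy's inequality on the disc of
  radius \<open>2 * n\<close>, where \<open>F\<close> is at most \<open>T powr O(n)\<close>, the tail of the expansion is at most
  \<open>T powr O(n) / 4 ^ m\<close>, which is negligible. On the other hand, \<open>z = T - \<i> * n\<close> has
  \<open>1 / 2 + \<i> * z = 1 / 2 + n + \<i> * T\<close>, where the Dirichlet series is bounded below, and the Gamma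
  quotient is a finite product there, so that \<open>\<bar>F (T - \<i> * n)\<bar> \<ge> exp (L * n) / 4\<close>. Hence
  \<open>exp ((L - B) * n) \<le> 24 * M\<close>, but the left side is at least \<open>(T / (2 * pi)) ^ 5\<close> while
  \<open>M\<close> is \<open>O(T ^ 4)\<close>.
\<close>

subsection \<open>The zeta function to the right of \<open>-1\<close>\<close>

text \<open>For \<open>Re s > 1\<close> this is \<open>zeta_series_recurrence\<close> solved for the
  remainder series. Both sides are holomorphic on \<open>Re s > 1 - K\<close> except at
  \<open>1, 0, ..., 2 - K\<close>, where one of the shifted arguments meets the pole of
  \<open>zeta\<close>. Removing finitely many points leaves the half-plane connected, so the
  identity continues.\<close>

lemma zeta_recurrence:
  fixes s :: complex
  assumes K: "K \<ge> 1" and s: "Re s > 1 - real K" "s \<notin> (\<lambda>j. 1 - of_nat j) ` {..<K}"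
  shows "(\<lambda>n. of_nat (Suc (Suc n)) powr (1 - s)
            - (\<Sum>j\<le>K. ((1 - s) gchoose j) * of_nat (Suc n) powr (1 - s - of_nat j)))
         sums ((s - 1) * zeta s - 1 + (\<Sum>j=2..K. ((1 - s) gchoose (j - 1)) / of_nat j *
                 ((s + of_nat j - 1 - 1) * zeta (s + of_nat j - 1))))"
proof -
  obtain R where R: "R holomorphic_on {s. Re s > 1 - real K}"
    "\<And>s. Re s > 1 - real K \<Longrightarrow> (\<lambda>n. of_nat (Suc (Suc n)) powr (1 - s)
            - (\<Sum>j\<le>K. ((1 - s) gchoose j) * of_nat (Suc n) powr (1 - s - of_nat j))) sums R s"
    using zeta_remainder_holomorphic[of K] by blast
  define P :: "complex set" where "P = (\<lambda>j. 1 - of_nat j) ` {..<K}"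
  define G where "G = (\<lambda>s. (s - 1) * zeta s - 1 + (\<Sum>j=2..K. ((1 - s) gchoose (j - 1)) / of_nat j *
                 ((s + of_nat j - 1 - 1) * zeta (s + of_nat j - 1))))"
  have "R s = G s"
  proof (rule analytic_continuation_open[of "{s. Re s > 1}" "{s. Re s > 1 - real K} - P" R G])
    have one: "1 \<in> P" using K by (auto simp: P_def intro!: image_eqI[of _ _ 0])
    show "open ({s. 1 - real K < Re s} - P)"
      by (intro open_Diff open_halfspace_Re_gt finite_imp_closed) (auto simp: P_def)
    show "connected ({s. 1 - real K < Re s} - P)"
      by (intro connected_open_diff_countable)
         (auto simp: P_def open_halfspace_Re_gt intro!: convex_connected convex_halfspace_Re_gt countable_finite)
    show "{s. Re s > 1} \<noteq> {}" by (auto intro!: exI[of _ "2 :: complex"])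
    show "{s. 1 < Re s} \<subseteq> {s. 1 - real K < Re s} - P" by (auto simp: P_def)
    show "R holomorphic_on {s. 1 - real K < Re s} - P"
      using R(1) by (rule holomorphic_on_subset) auto
    have "(\<lambda>s. zeta (s + of_nat j - 1)) holomorphic_on {s. 1 - real K < Re s} - P" if "j \<in> {1..K}" for j
    proof (rule holomorphic_on_compose_gen[OF _ zeta_holomorphic, unfolded o_def])
      show "(\<lambda>s. s + of_nat j - 1) ` ({s. 1 - real K < Re s} - P) \<subseteq> - {1}"
      proof safe
        fix s assume "s \<notin> P" "s + of_nat j - 1 = 1"
        moreover from this have "s = 1 - of_nat (j - 1)" using that by (simp add: of_nat_diff algebra_simps)
        moreover have "j - 1 < K" using that by auto
        ultimately show False by (auto simp: P_def)
      qed
    qed (intro holomorphic_intros)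
    moreover have "zeta holomorphic_on {s. 1 - real K < Re s} - P"
      using one by (intro holomorphic_on_subset[OF zeta_holomorphic]) auto
    ultimately show "G holomorphic_on {s. 1 - real K < Re s} - P"
      unfolding G_def by (intro holomorphic_intros holomorphic_gbinomial) auto
    show "R z = G z" if "z \<in> {s. 1 < Re s}" for z
    proof -
      have z: "Re z > 1" "Re z > 1 - real K" using that by auto
      have "(z - 1) * zeta z = 1 + R z - (\<Sum>j=2..K. ((1 - z) gchoose (j - 1)) / of_nat j *
          ((z + of_nat j - 1 - 1) * zeta (z + of_nat j - 1)))"
        unfolding zeta_eq_series[OF z(1)] zeta_series_recurrence[OF z(1) K R(2)[OF z(2)]] using z
        by (intro arg_cong2[of _ _ _ _ "(-)"] refl sum.cong) (subst zeta_eq_series, auto)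
      then show ?thesis by (simp add: G_def)
    qed
  qed (use s in \<open>auto simp: P_def open_halfspace_Re_gt\<close>)
  then show ?thesis using R(2)[OF s(1)] by (simp only: G_def)
qed

text \<open>The case \<open>K = 1\<close> of \<open>zeta_recurrence\<close>, telescoped: an
  Euler-Maclaurin formula with the integral term only.\<close>

lemma zeta_limit_1:
  fixes s :: complex
  assumes "Re s > 0" "s \<noteq> 1"
  shows "(\<lambda>N. of_nat (Suc N) powr (1 - s) - (1 - s) * (\<Sum>n<N. of_nat (Suc n) powr (- s)))
           \<longlonglongrightarrow> (s - 1) * zeta s"
proof -
  have ivl: "{..1::nat} = {0,1}" "(\<lambda>j. 1 - of_nat j :: complex) ` {..<1} = {1}" by auto
  have o1: "complex_of_nat (Suc 0) = 1" by simp
  have "(\<lambda>N. \<Sum>n<N. of_nat (Suc (Suc n)) powr (1 - s) - of_nat (Suc n) powr (1 - s)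
            - (1 - s) * of_nat (Suc n) powr (- s)) \<longlonglongrightarrow> (s - 1) * zeta s - 1"
    using zeta_recurrence[of 1 s] assms unfolding ivl
    by (simp add: sums_def diff_diff_eq o1 del: of_nat_Suc)
  also have "(\<lambda>N. \<Sum>n<N. of_nat (Suc (Suc n)) powr (1 - s) - of_nat (Suc n) powr (1 - s)
            - (1 - s) * of_nat (Suc n) powr (- s))
      = (\<lambda>N. of_nat (Suc N) powr (1 - s) - (1 - s) * (\<Sum>n<N. of_nat (Suc n) powr (- s)) - 1)"
  proof
    fix N show "(\<Sum>n<N. of_nat (Suc (Suc n)) powr (1 - s) - of_nat (Suc n) powr (1 - s)
            - (1 - s) * of_nat (Suc n) powr (- s))
      = of_nat (Suc N) powr (1 - s) - (1 - s) * (\<Sum>n<N. of_nat (Suc n) powr (- s)) - 1"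
      by (induction N) (simp_all add: algebra_simps del: of_nat_Suc, simp)
  qed
  finally have "(\<lambda>N. of_nat (Suc N) powr (1 - s) - (1 - s) * (\<Sum>n<N. of_nat (Suc n) powr (- s)) - 1 + 1)
     \<longlonglongrightarrow> (s - 1) * zeta s - 1 + 1" by (intro tendsto_add tendsto_const)
  then show ?thesis by simp
qed

text \<open>The case \<open>K = 2\<close> gives one more Euler-Maclaurin term, the half boundary
  term, and reaches the strip \<open>-1 < Re s < 0\<close> where the functional equation is first
  proved.\<close>

lemma zeta_limit_2:
  fixes s :: complex
  assumes s: "Re s > -1" "s \<noteq> 0" "s \<noteq> 1"
  shows "(\<lambda>N. of_nat (Suc N) powr (1 - s) - (1 - s) * (\<Sum>n<N. of_nat (Suc n) powr (- s))
              - (1 - s) / 2 * of_nat (Suc N) powr (- s)) \<longlonglongrightarrow> (s - 1) * zeta s"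
proof -
  have g2: "(1 - s) gchoose 2 = - ((1 - s) * s / 2)"
    by (simp add: gbinomial_prod_rev numeral_2_eq_2 lessThan_Suc)
  have ivl: "{..2::nat} = {0,1,2}" "{2..2::nat} = {2}" "{..<2::nat} = {0,1}" by auto
  let ?a = "\<lambda>N. of_nat (Suc N) powr (1 - s) - (1 - s) * (\<Sum>n<N. of_nat (Suc n) powr (- s))
           + (1 - s) * s / 2 * (\<Sum>n<N. of_nat (Suc n) powr (- s - 1))"
  have "(\<lambda>N. \<Sum>n<N. of_nat (Suc (Suc n)) powr (1 - s) - of_nat (Suc n) powr (1 - s)
            - (1 - s) * of_nat (Suc n) powr (- s) + (1 - s) * s / 2 * of_nat (Suc n) powr (- s - 1))
      \<longlonglongrightarrow> (s - 1) * zeta s - 1 + (1 - s) / 2 * (s * zeta (s + 1))"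
  proof -
    have o1: "complex_of_nat (Suc 0) = 1" by simp
    have e: "2 - (1::nat) = Suc 0" "1 - s - 2 = - s - 1" "s + 2 - 1 - 1 = s" "s + 2 - 1 = s + 1" by auto
    have "(\<lambda>n. of_nat (Suc (Suc n)) powr (1 - s) - (of_nat (Suc n) powr (1 - s) +
             ((1 - s) * of_nat (Suc n) powr (- s) + - ((1 - s) * s / 2) * of_nat (Suc n) powr (- s - 1))))
        sums ((s - 1) * zeta s - 1 + (1 - s) / 2 * (s * zeta (s + 1)))"
      using zeta_recurrence[of 2 s] s unfolding ivl
      by (simp add: g2 e o1 del: of_nat_Suc)
    then show ?thesis
      by (simp add: sums_def algebra_simps del: of_nat_Suc)
  qed
  also have "(\<lambda>N. \<Sum>n<N. of_nat (Suc (Suc n)) powr (1 - s) - of_nat (Suc n) powr (1 - s)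
            - (1 - s) * of_nat (Suc n) powr (- s) + (1 - s) * s / 2 * of_nat (Suc n) powr (- s - 1))
      = (\<lambda>N. ?a N - 1)"
  proof
    fix N show "(\<Sum>n<N. of_nat (Suc (Suc n)) powr (1 - s) - of_nat (Suc n) powr (1 - s)
            - (1 - s) * of_nat (Suc n) powr (- s) + (1 - s) * s / 2 * of_nat (Suc n) powr (- s - 1)) = ?a N - 1"
      by (induction N) (simp_all add: algebra_simps del: of_nat_Suc, simp)
  qed
  finally have 1: "(\<lambda>N. ?a N - 1) \<longlonglongrightarrow> (s - 1) * zeta s - 1 + (1 - s) / 2 * (s * zeta (s + 1))" .
  \<comment> \<open>The unwanted sums of \<open>n powr (- s - 1)\<close> and the value
    \<open>zeta (s + 1)\<close> are eliminated together by the previous lemma at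
    \<open>s + 1\<close>.\<close>
  have "(\<lambda>N. of_nat (Suc N) powr (1 - (s + 1)) - (1 - (s + 1)) * (\<Sum>n<N. of_nat (Suc n) powr (- (s + 1))))
           \<longlonglongrightarrow> (s + 1 - 1) * zeta (s + 1)"
    using s by (intro zeta_limit_1) auto
  then have 2: "(\<lambda>N. of_nat (Suc N) powr (- s) + s * (\<Sum>n<N. of_nat (Suc n) powr (- s - 1))) \<longlonglongrightarrow> s * zeta (s + 1)"
  proof -
    have e: "1 - (s + 1) = - s" "- (s + 1) = - s - 1" "s + 1 - 1 = s" by auto
    assume "(\<lambda>N. of_nat (Suc N) powr (1 - (s + 1)) - (1 - (s + 1)) * (\<Sum>n<N. of_nat (Suc n) powr (- (s + 1))))
           \<longlonglongrightarrow> (s + 1 - 1) * zeta (s + 1)"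
    then show ?thesis unfolding e by simp
  qed
  have "(\<lambda>N. ?a N - 1 + 1 - (1 - s) / 2 * (of_nat (Suc N) powr (- s) + s * (\<Sum>n<N. of_nat (Suc n) powr (- s - 1))))
     \<longlonglongrightarrow> (s - 1) * zeta s - 1 + (1 - s) / 2 * (s * zeta (s + 1)) + 1 - (1 - s) / 2 * (s * zeta (s + 1))"
    by (intro tendsto_intros 1 2)
  then show ?thesis by (simp add: algebra_simps del: of_nat_Suc)
qed

section \<open>Upper and lower bounds for zeta\<close>

text \<open>For \<open>K = 1\<close> and \<open>Re s \<ge> 1 / 2\<close> the terms of the remainder
  series are at most \<open>cmod (s - 1) * cmod s\<close> times a term of a convergent series, so
  the factor \<open>s - 1\<close> cancels.\<close>

lemma zeta_growth:
  obtains c where "c > 0" "\<And>s. Re s \<ge> 1 / 2 \<Longrightarrow> cmod (s - 1) \<ge> 1 \<Longrightarrow> cmod (zeta s) \<le> c * cmod s"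
proof -
  define c where "c = (\<Sum>n. real (Suc n) powr (- (3/2)))"
  have sm: "summable (\<lambda>n. real (Suc n) powr (- (3/2)))"
    by (subst summable_Suc_iff) (simp add: summable_real_powr_iff)
  have c0: "c \<ge> 0" unfolding c_def by (intro suminf_nonneg sm) auto
  show ?thesis
  proof (rule that[of "c + 2"])
    fix s :: complex assume s: "Re s \<ge> 1 / 2" "cmod (s - 1) \<ge> 1"
    have g2: "(1 - s) gchoose Suc 1 = - ((1 - s) * s / 2)"
      by (simp add: gbinomial_prod_rev lessThan_Suc)
    define r where "r = (\<lambda>n. of_nat (Suc (Suc n)) powr (1 - s)
            - (\<Sum>j\<le>1. ((1 - s) gchoose j) * of_nat (Suc n) powr (1 - s - of_nat j)))"
    have sums: "r sums ((s - 1) * zeta s - 1)"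
    proof -
      have ivl: "(\<lambda>j. 1 - of_nat j :: complex) ` {..<1} = {1}" "{2..1::nat} = {}" by auto
      have "s \<noteq> 1" "Re s > 1 - real 1" using s by auto
      then show ?thesis using zeta_recurrence[of 1 s]
        unfolding r_def ivl by (simp only: sum.empty add_0_right order.refl singleton_iff simp_thms)
    qed
    have r: "cmod (r n) \<le> cmod (s - 1) * cmod s * real (Suc n) powr (- (3/2))" for n
    proof -
      have "cmod (r n) \<le> real (Suc 1) * cmod ((1 - s) gchoose Suc 1) * real (Suc n) powr (- Re s - real 1)"
        unfolding r_def using s by (intro zeta_remainder_bound) auto
      also have "\<dots> = cmod (s - 1) * cmod s * real (Suc n) powr (- Re s - 1)"
        unfolding g2 by (simp add: norm_mult norm_divide norm_minus_commute)
      also have "\<dots> \<le> cmod (s - 1) * cmod s * real (Suc n) powr (- (3/2))"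
        using s by (intro mult_left_mono powr_mono) auto
      finally show ?thesis .
    qed
    have "cmod ((s - 1) * zeta s - 1) \<le> (\<Sum>n. cmod (s - 1) * cmod s * real (Suc n) powr (- (3/2)))"
      unfolding sums_unique[OF sums] by (intro norm_suminf_le r summable_mult sm)
    also have "\<dots> = cmod (s - 1) * cmod s * c"
      unfolding c_def by (rule suminf_mult[OF sm])
    finally have "cmod ((s - 1) * zeta s) \<le> 1 + cmod (s - 1) * cmod s * c"
      using norm_triangle_sub[of "(s - 1) * zeta s" 1] by simp
    \<comment> \<open>This absorbs the summand \<open>1\<close> into the main term and accounts for
      the \<open>2\<close> in the constant \<open>c + 2\<close>.\<close>
    moreover have "1 \<le> cmod (s - 1) * (2 * cmod s)"
    proof -
      have "1/2 \<le> cmod s" using s(1) complex_Re_le_cmod[of s] by linarith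
      then have "1 * 1 \<le> cmod (s - 1) * (2 * cmod s)" using s by (intro mult_mono) auto
      then show ?thesis by simp
    qed
    ultimately have "cmod (s - 1) * cmod (zeta s) \<le> cmod (s - 1) * (2 * cmod s) + cmod (s - 1) * cmod s * c"
      by (simp add: norm_mult)
    also have "\<dots> = cmod (s - 1) * ((c + 2) * cmod s)" by (simp add: algebra_simps)
    finally have "cmod (s - 1) * cmod (zeta s) \<le> cmod (s - 1) * ((c + 2) * cmod s)" .
    then show "cmod (zeta s) \<le> (c + 2) * cmod s"
      using s(2) by (auto simp: mult_le_cancel_left)
  qed (use c0 in auto)
qed

text \<open>The first term of the Dirichlet series is \<open>1\<close>, and the others add up to at
  most \<open>pi\<^sup>2 / 6 - 1 < 3 / 4\<close> in modulus.\<close>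

lemma zeta_lower_bound:
  assumes s: "Re s \<ge> 3"
  shows "cmod (zeta s) \<ge> 1 / 4"
proof -
  define f where "f = (\<lambda>n. 1 / of_nat (Suc n) powr s :: complex)"
  have f0: "f 0 = 1" by (simp add: f_def)
  have fs: "summable f" unfolding f_def using s by (intro zeta_series_summable) auto
  have "zeta s = suminf f" unfolding f_def using s by (intro zeta_eq_series) auto
  also have "\<dots> = (\<Sum>n. f (Suc n)) + 1"
    using suminf_split_head[OF fs] f0 by simp
  finally have z: "zeta s - 1 = (\<Sum>n. f (Suc n))" by simp
  have sm: "(\<lambda>n. 1 / (real n + 1)\<^sup>2) sums (pi\<^sup>2 / 6)" using inverse_squares_sums by (simp add: add.commute)
  have sm1: "(\<lambda>n. 1 / (real (Suc n) + 1)\<^sup>2) sums (pi\<^sup>2 / 6 - 1)"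
    using sums_Suc_iff[of "\<lambda>n. 1 / (real n + 1)\<^sup>2" "pi\<^sup>2 / 6 - 1"] sm by simp
  have le: "cmod (f (Suc n)) \<le> 1 / (real (Suc n) + 1)\<^sup>2" for n
  proof -
    have "cmod (f (Suc n)) = 1 / (real (Suc n) + 1) powr (Re s)"
      by (simp add: f_def norm_divide norm_powr_real_powr add.commute)
    also have "\<dots> \<le> 1 / (real (Suc n) + 1) powr 2"
      using s by (intro divide_left_mono powr_mono) auto
    finally show ?thesis by simp
  qed
  have "cmod (zeta s - 1) \<le> (\<Sum>n. 1 / (real (Suc n) + 1)\<^sup>2)"
    unfolding z using le sm1 by (intro norm_suminf_le) (auto simp: sums_iff)
  also have "\<dots> = pi\<^sup>2 / 6 - 1" using sm1 by (simp add: sums_iff)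
  also have "pi\<^sup>2 \<le> 3.2\<^sup>2" using pi_less_4 pi_approx by (intro power_mono) auto
  finally have "cmod (zeta s - 1) \<le> 3 / 4" by (simp add: power2_eq_square)
  then show ?thesis using norm_triangle_ineq2[of 1 "1 - zeta s"] by (simp add: norm_minus_commute)
qed

subsection \<open>The functional equation\<close>

text \<open>Logarithmic differentiation of the reflection formula, at \<open>z = \<i> * x / (2 * pi)\<close>.\<close>

lemma coth_partial_fractions:
  fixes x :: real
  assumes x: "x > 0"
  shows "(\<lambda>n. 2 * x / (x\<^sup>2 + (2 * pi * real (Suc n))\<^sup>2)) sums (1 / (exp x - 1) - 1 / x + 1 / 2)"
proof -
  define z where "z = \<i> * of_real (x / (2 * pi))"
  have zR: "Re z = 0" "Im z > 0" using x by (auto simp: z_def)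
  have nz: "1 + z \<notin> \<int>\<^sub>\<le>\<^sub>0" "1 - z \<notin> \<int>\<^sub>\<le>\<^sub>0" "z \<notin> \<int>\<^sub>\<le>\<^sub>0" "z \<noteq> 0" "-z \<notin> \<int>\<^sub>\<le>\<^sub>0" "1 + z \<noteq> 0" "1 - z \<noteq> 0"
    using zR by (auto simp: complex_eq_iff complex_is_Int_iff dest!: nonpos_Ints_Int)
  have sn: "sin (of_real pi * z) \<noteq> 0"
    using nz by (metis rGamma_reflection_complex' rGamma_eq_zero_iff mult_eq_0_iff mult_zero_right div_0)
  have "((\<lambda>w. rGamma (1 + w) * rGamma (1 - w) * w) has_field_derivative
          (rGamma (1 + z) * rGamma (1 - z)) * (1 - z * (Digamma (1 + z) - Digamma (1 - z)))) (at z)"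
    using nz by (auto intro!: derivative_eq_intros simp: algebra_simps)
  moreover have "(\<lambda>w::complex. rGamma (1 + w) * rGamma (1 - w) * w) = (\<lambda>w. sin (of_real pi * w) / of_real pi)"
  proof
    fix w :: complex
    show "rGamma (1 + w) * rGamma (1 - w) * w = sin (of_real pi * w) / of_real pi"
      unfolding rGamma_reflection_complex[of w, symmetric] rGamma_plus1[of w, symmetric]
      by (simp only: add.commute[of 1 w] mult_ac)
  qed
  moreover have "((\<lambda>w. sin (of_real pi * w) / of_real pi) has_field_derivative cos (of_real pi * z)) (at z)"
    by (auto intro!: derivative_eq_intros)
  ultimately have "(rGamma (1 + z) * rGamma (1 - z)) * (1 - z * (Digamma (1 + z) - Digamma (1 - z))) = cos (of_real pi * z)"
    by (simp only: DERIV_unique)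
  moreover have "rGamma (1 + z) * rGamma (1 - z) = sin (of_real pi * z) / (of_real pi * z)"
  proof -
    have "rGamma (1 + z) = rGamma z / z" using rGamma_plus1[of z] nz by (simp add: add_ac field_simps)
    then have "rGamma (1 + z) * rGamma (1 - z) = (rGamma z * rGamma (1 - z)) / z" by simp
    then show ?thesis unfolding rGamma_reflection_complex by simp
  qed
  ultimately have D: "Digamma (1 + z) - Digamma (1 - z) = 1 / z - of_real pi * cos (of_real pi * z) / sin (of_real pi * z)"
  proof -
    have "D = 1 / z - of_real pi * c / w" if "P * (1 - z * D) = c" "P = w / (of_real pi * z)" "w \<noteq> 0" for P D c w
      using that nz by (auto simp: field_simps)
    then show "\<lbrakk>(rGamma (1 + z) * rGamma (1 - z)) * (1 - z * (Digamma (1 + z) - Digamma (1 - z))) = cos (of_real pi * z);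
      rGamma (1 + z) * rGamma (1 - z) = sin (of_real pi * z) / (of_real pi * z)\<rbrakk> \<Longrightarrow> ?thesis"
      using sn by blast
  qed
  \<comment> \<open>In the difference of the two Digamma series the Euler constant and the terms
    \<open>inverse (of_nat (Suc k))\<close> cancel; what remains pairs up into the desired
    summands.\<close>
  have "(\<lambda>k. (inverse (of_nat (Suc k)) - inverse ((1 + z) + of_nat k)) - (inverse (of_nat (Suc k)) - inverse ((1 - z) + of_nat k)))
     sums ((Digamma (1 + z) + euler_mascheroni) - (Digamma (1 - z) + euler_mascheroni))"
    using nz by (intro sums_diff) (auto simp: Digamma_def simp del: of_nat_Suc intro!: summable_sums summable_Digamma)
  then have S: "(\<lambda>k. inverse ((1 - z) + of_nat k) - inverse ((1 + z) + of_nat k)) sums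
       (1 / z - of_real pi * cos (of_real pi * z) / sin (of_real pi * z))"
    by (simp add: D)
  have t: "inverse ((1 - z) + of_nat k) - inverse ((1 + z) + of_nat k)
       = 2 * pi * \<i> * of_real (2 * x / (x\<^sup>2 + (2 * pi * real (Suc k))\<^sup>2))" for k
  proof -
    have n: "(1 - z) + of_nat k \<noteq> 0" "(1 + z) + of_nat k \<noteq> 0" using zR by (auto simp: complex_eq_iff)
    have z2: "z * z = - of_real (x\<^sup>2 / (4 * pi\<^sup>2))"
    proof -
      have "z\<^sup>2 = - of_real (x\<^sup>2 / (4 * pi\<^sup>2))" by (simp add: z_def power_mult_distrib power_divide)
      then show ?thesis by (simp only: power2_eq_square)
    qed
    have "inverse ((1 - z) + of_nat k) - inverse ((1 + z) + of_nat k)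
        = 2 * z / ((of_nat (Suc k))\<^sup>2 - z * z)"
      using n by (simp add: field_simps power2_eq_square)
    also have "(of_nat (Suc k))\<^sup>2 - z * z = of_real ((x\<^sup>2 + (2 * pi * real (Suc k))\<^sup>2) / (4 * pi\<^sup>2))"
      unfolding z2 by (simp add: field_simps del: of_nat_Suc)
    also have "2 * z = \<i> * of_real (x / pi)" by (simp add: z_def)
    finally show ?thesis
      by (simp add: field_simps power2_eq_square del: of_nat_Suc)
  qed
  have e1: "exp x > 1" using x by simp
  \<comment> \<open>The argument is \<open>\<i> * x / 2\<close>, so the cotangent is
    \<open>- \<i>\<close> times the hyperbolic cotangent of \<open>x / 2\<close>.\<close>
  have cs: "cos (of_real pi * z) / sin (of_real pi * z) = - \<i> * of_real ((exp x + 1) / (exp x - 1))"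
  proof -
    have a: "of_real pi * z = \<i> * of_real (x / 2)" by (simp add: z_def)
    have b: "exp (\<i> * (of_real pi * z)) = of_real (exp (- x / 2))" "exp (- (\<i> * (of_real pi * z))) = of_real (exp (x / 2))"
      unfolding a by (simp_all flip: exp_of_real)
    define E :: complex where "E = of_real (exp (x / 2))"
    have c: "complex_of_real (exp x) = E * E" "complex_of_real (exp (- x / 2)) = 1 / E"
      by (simp_all add: E_def exp_minus field_simps flip: of_real_mult exp_add)
    have d: "E \<noteq> 0" by (simp add: E_def)
    have f: "E * E \<noteq> 1" unfolding c(1)[symmetric] using e1 by simp
    have "cos (of_real pi * z) / sin (of_real pi * z) = - \<i> * ((E * E + 1) / (E * E - 1))"
      unfolding cos_exp_eq sin_exp_eq b c(2) E_def[symmetric] using d f by (simp add: field_simps)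
    then show ?thesis by (simp add: c(1))
  qed
  have v: "1 / z - of_real pi * cos (of_real pi * z) / sin (of_real pi * z)
     = 2 * pi * \<i> * of_real (1 / (exp x - 1) - 1 / x + 1 / 2)"
  proof -
    have "1 / z = - \<i> * of_real (2 * pi / x)" using x by (simp add: z_def field_simps)
    moreover have "of_real pi * cos (of_real pi * z) / sin (of_real pi * z) = - \<i> * of_real (pi * ((exp x + 1) / (exp x - 1)))"
      using cs by (metis (no_types, lifting) times_divide_eq_right mult.left_commute of_real_mult)
    moreover have "- (2 * pi / x) + pi * ((exp x + 1) / (exp x - 1)) = 2 * pi * (1 / (exp x - 1) - 1 / x + 1 / 2)"
      using x e1 by (simp add: field_simps)
    ultimately show ?thesis
      by (simp add: complex_eq_iff)
  qed
  from S have "(\<lambda>k. 2 * pi * \<i> * of_real (2 * x / (x\<^sup>2 + (2 * pi * real (Suc k))\<^sup>2))) sums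
      (2 * pi * \<i> * of_real (1 / (exp x - 1) - 1 / x + 1 / 2))"
    unfolding t v .
  then have "(\<lambda>k. complex_of_real (2 * x / (x\<^sup>2 + (2 * pi * real (Suc k))\<^sup>2))) sums
      of_real (1 / (exp x - 1) - 1 / x + 1 / 2)"
    by (subst (asm) sums_mult_iff) auto
  then show ?thesis by (simp only: sums_of_real_iff)
qed

section \<open>Gamma and Beta integrals over the half-line\<close>

text \<open>The substitution \<open>t = 1 / (1 + x\<^sup>2)\<close> turns the Beta integral with
  parameters \<open>(1 - s) / 2\<close> and \<open>(1 + s) / 2\<close> into twice this integral. The
  parameters add up to \<open>1\<close>, so the Beta function is a product of two Gamma
  values.\<close>

lemma nn_integral_powr_over_one_plus_square:
  fixes s :: real
  assumes s: "-1 < s" "s < 1"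
  shows "(\<integral>\<^sup>+x. ennreal (x powr s / (1 + x\<^sup>2)) * indicator {0<..} x \<partial>lborel)
          = ennreal (Gamma ((1 + s) / 2) * Gamma ((1 - s) / 2) / 2)"
proof -
  define a b where "a = (1 - s) / 2" and "b = (1 + s) / 2"
  have ab: "a > 0" "b > 0" "a + b = 1" using s by (auto simp: a_def b_def field_simps)
  define f where "f = (\<lambda>t. t powr (a - 1) * (1 - t) powr (b - 1) :: real)"
  define g where "g = (\<lambda>x. 1 / (1 + x\<^sup>2) :: real)"
  define g' where "g' = (\<lambda>x. - 2 * x / (1 + x\<^sup>2)\<^sup>2 :: real)"
  have p: "1 + x\<^sup>2 \<noteq> 0" "1 + x\<^sup>2 > 0" for x :: real by (auto simp: add_pos_nonneg add_nonneg_eq_0_iff)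
  have img: "g ` {0<..} = {0<..<1}"
  proof (intro equalityI subsetI)
    fix t :: real assume t: "t \<in> {0<..<1}"
    then show "t \<in> g ` {0<..}"
      by (intro image_eqI[of _ _ "sqrt (1 / t - 1)"]) (auto simp: g_def field_simps)
  qed (use p in \<open>auto simp: g_def field_simps\<close>)
  have "(\<lambda>x. \<bar>g' x\<bar> * f (g x)) absolutely_integrable_on {0<..} \<and> integral {0<..} (\<lambda>x. \<bar>g' x\<bar> * f (g x)) = Beta a b
    \<longleftrightarrow> f absolutely_integrable_on (g ` {0<..}) \<and> integral (g ` {0<..}) f = Beta a b"
  proof (rule has_absolute_integral_change_of_variables_1')
    show "inj_on g {0<..}"
      by (intro inj_onI) (auto simp: g_def power2_eq_iff)
    show "(g has_field_derivative g' x) (at x within {0<..})" for x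
      unfolding g_def g'_def using p[of x]
      by (auto intro!: derivative_eq_intros simp: power2_eq_square field_simps)
  qed simp
  moreover have hi: "(f has_integral Beta a b) {0<..<1}"
    using has_integral_Beta_real[OF ab(1,2)] unfolding f_def
    by (subst has_integral_Icc_iff_Ioo [symmetric])
  moreover have "f absolutely_integrable_on {0<..<1}"
    using hi by (intro nonnegative_absolutely_integrable_1) (auto simp: f_def)
  ultimately have G: "(\<lambda>x. \<bar>g' x\<bar> * f (g x)) absolutely_integrable_on {0<..}"
       "integral {0<..} (\<lambda>x. \<bar>g' x\<bar> * f (g x)) = Beta a b"
    unfolding img by (auto simp: has_integral_iff)
  then have "((\<lambda>x. \<bar>g' x\<bar> * f (g x)) has_integral Beta a b) {0<..}"
    by (auto simp: has_integral_iff absolutely_integrable_on_def)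
  then have "((\<lambda>x. 2 * (x powr s / (1 + x\<^sup>2))) has_integral Beta a b) {0<..}"
  proof (rule has_integral_eq[rotated])
    fix x :: real assume "x \<in> {0<..}"
    then have x: "x > 0" by simp
    have "f (g x) = (1 + x\<^sup>2) powr (1 - a) * (x\<^sup>2 / (1 + x\<^sup>2)) powr (b - 1)"
    proof -
      have "1 - g x = x\<^sup>2 / (1 + x\<^sup>2)" using p[of x] by (simp add: g_def field_simps)
      moreover have "g x powr (a - 1) = (1 + x\<^sup>2) powr (1 - a)"
        using p[of x] by (simp add: g_def powr_divide powr_minus_divide[symmetric])
      ultimately show ?thesis by (simp add: f_def)
    qed
    also have "\<dots> = (1 + x\<^sup>2) powr b * (x powr (2 * (b - 1)) / (1 + x\<^sup>2) powr (b - 1))"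
    proof -
      have "1 - a = b" using ab(3) by simp
      moreover have "(x\<^sup>2) powr (b - 1) = x powr (2 * (b - 1))" using x by (simp add: powr_powr flip: powr_numeral)
      ultimately show ?thesis using p[of x] by (simp add: powr_divide)
    qed
    also have "\<dots> = ((1 + x\<^sup>2) powr b / (1 + x\<^sup>2) powr (b - 1)) * x powr (s - 1)"
    proof -
      have "2 * (b - 1) = s - 1" by (simp add: b_def field_simps)
      then show ?thesis by simp
    qed
    also have "(1 + x\<^sup>2) powr b / (1 + x\<^sup>2) powr (b - 1) = 1 + x\<^sup>2"
      using p[of x] by (simp flip: powr_diff)
    finally have "f (g x) = (1 + x\<^sup>2) * x powr (s - 1)" .
    moreover have "\<bar>g' x\<bar> = 2 * x / (1 + x\<^sup>2)\<^sup>2" using x by (simp add: g'_def)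
    moreover have "x powr s = x * x powr (s - 1)" using x by (simp add: powr_diff)
    ultimately show "\<bar>g' x\<bar> * f (g x) = 2 * (x powr s / (1 + x\<^sup>2))"
      using p[of x] by (simp add: power2_eq_square)
  qed
  then have "((\<lambda>x. 1 / 2 * (2 * (x powr s / (1 + x\<^sup>2)))) has_integral 1 / 2 * Beta a b) {0<..}"
    by (rule has_integral_mult_right)
  then have "((\<lambda>x. x powr s / (1 + x\<^sup>2)) has_integral 1 / 2 * Beta a b) {0<..}" by simp
  then have "(\<integral>\<^sup>+x. ennreal (x powr s / (1 + x\<^sup>2)) * indicator {0<..} x \<partial>lborel) = ennreal (1 / 2 * Beta a b)"
    by (intro nn_integral_has_integral_lebesgue') auto
  also have "1 / 2 * Beta a b = Gamma b * Gamma a / 2"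
    using ab by (simp add: Beta_def mult_ac)
  finally show ?thesis by (simp add: a_def b_def)
qed

lemma nn_integral_powr_exp:
  fixes b p :: real
  assumes b: "b > 0" and p: "p > 0"
  shows "(\<integral>\<^sup>+x. ennreal (x powr (p - 1) * exp (- (b * x))) * indicator {0<..} x \<partial>lborel)
           = ennreal (Gamma p * b powr (- p))"
proof -
  have "(\<integral>\<^sup>+x. ennreal (x powr (p - 1) * exp (- (b * x))) * indicator {0<..} x \<partial>lborel)
      = ennreal \<bar>1 / b\<bar> * (\<integral>\<^sup>+x. ennreal ((0 + 1 / b * x) powr (p - 1) * exp (- (b * (0 + 1 / b * x))))
             * indicator {0<..} (0 + 1 / b * x) \<partial>lborel)"
    using b by (intro nn_integral_real_affine) auto
  also have "(\<integral>\<^sup>+x. ennreal ((0 + 1 / b * x) powr (p - 1) * exp (- (b * (0 + 1 / b * x))))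
             * indicator {0<..} (0 + 1 / b * x) \<partial>lborel)
      = (\<integral>\<^sup>+x. ennreal (b powr (1 - p)) * (ennreal (x powr (p - 1) / exp x) * indicator {0..} x) \<partial>lborel)"
  proof (intro nn_integral_cong)
    fix x :: real
    have "(x / b) powr (p - 1) = b powr (1 - p) * x powr (p - 1)" if "x > 0"
      using that b by (simp add: powr_divide powr_diff field_simps)
    then show "ennreal ((0 + 1 / b * x) powr (p - 1) * exp (- (b * (0 + 1 / b * x)))) * indicator {0<..} (0 + 1 / b * x)
        = ennreal (b powr (1 - p)) * (ennreal (x powr (p - 1) / exp x) * indicator {0..} x)"
      using b by (cases "x > 0"; cases "x = 0")
        (auto simp: exp_minus field_simps zero_less_divide_iff zero_less_mult_iff indicator_def simp flip: ennreal_mult)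
  qed
  also have "\<dots> = ennreal (b powr (1 - p)) * ennreal (Gamma p)"
    using nn_integral_has_integral_lebesgue'[OF _ Gamma_integral_real[OF p]]
    by (subst nn_integral_cmult) auto
  also have "ennreal \<bar>1 / b\<bar> * \<dots> = ennreal (Gamma p * b powr (- p))"
    using b p by (simp add: Gamma_real_pos less_imp_le powr_diff powr_minus field_simps flip: ennreal_mult)
  finally show ?thesis .
qed

text \<open>Tonelli's theorem, packaged for repeated use: integrating in the parameter
  \<open>b\<close> from \<open>0\<close> to \<open>a\<close> raises the order of vanishing at
  \<open>x = 0\<close>, which carries the Gamma integral to exponents where it diverges by
  itself.\<close>

lemma nn_integral_parameter_integral:
  fixes g :: "real \<Rightarrow> real \<Rightarrow> real"
  assumes [measurable]: "(\<lambda>(b, x). g b x) \<in> borel_measurable (borel \<Otimes>\<^sub>M borel)"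
    and nonneg: "\<And>b x. b \<ge> 0 \<Longrightarrow> x > 0 \<Longrightarrow> g b x \<ge> 0"
    and a: "a > 0" and q: "q < 1" and c: "c \<ge> 0"
    and int_x: "\<And>b. b > 0 \<Longrightarrow> (\<integral>\<^sup>+x. ennreal (g b x) * indicator {0<..} x \<partial>lborel) = ennreal (c * b powr (- q))"
    and int_b: "\<And>x. x > 0 \<Longrightarrow> ((\<lambda>b. g b x) has_integral G x) {0..a}"
  shows "(\<integral>\<^sup>+x. ennreal (G x) * indicator {0<..} x \<partial>lborel) = ennreal (c * a powr (1 - q) / (1 - q))"
proof -
  have "(\<integral>\<^sup>+x. ennreal (G x) * indicator {0<..} x \<partial>lborel)
     = (\<integral>\<^sup>+x. (\<integral>\<^sup>+b. ennreal (g b x) * indicator {0..a} b * indicator {0<..} x \<partial>lborel) \<partial>lborel)"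
  proof (intro nn_integral_cong)
    fix x :: real
    show "ennreal (G x) * indicator {0<..} x = (\<integral>\<^sup>+b. ennreal (g b x) * indicator {0..a} b * indicator {0<..} x \<partial>lborel)"
    proof (cases "x > 0")
      case True
      then have "(\<integral>\<^sup>+b. ennreal (g b x) * indicator {0..a} b \<partial>lborel) = ennreal (G x)"
        using nonneg by (intro nn_integral_has_integral_lebesgue' int_b) auto
      then show ?thesis using True by simp
    qed simp
  qed
  also have "\<dots> = (\<integral>\<^sup>+b. (\<integral>\<^sup>+x. ennreal (g b x) * indicator {0..a} b * indicator {0<..} x \<partial>lborel) \<partial>lborel)"
    by (rule lborel_pair.Fubini') measurable
  also have "\<dots> = (\<integral>\<^sup>+b. ennreal (c * b powr (- q)) * indicator {0..a} b \<partial>lborel)"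
  proof (rule nn_integral_cong_AE)
    \<comment> \<open>The inner integral is known for \<open>b > 0\<close> only; the endpoint
      \<open>b = 0\<close> is a null set.\<close>
    have "AE b in lborel. b \<noteq> (0::real)" by (rule AE_lborel_singleton)
    then show "AE b in lborel. (\<integral>\<^sup>+x. ennreal (g b x) * indicator {0..a} b * indicator {0<..} x \<partial>lborel)
       = ennreal (c * b powr (- q)) * indicator {0..a} b"
    proof eventually_elim
      case (elim b)
      then show ?case using int_x[of b] by (auto simp: indicator_def)
    qed
  qed
  also have "\<dots> = ennreal (c * (a powr (- q + 1) / (- q + 1)))"
    using q a c by (intro nn_integral_has_integral_lebesgue' has_integral_mult_right has_integral_powr_from_0) auto
  finally show ?thesis by (simp add: add.commute)
qed

text \<open>Represents \<open>a powr (- s)\<close> for negative \<open>s\<close>, where the Gamma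
  integral diverges at \<open>0\<close>. It comes from integrating
  \<open>x powr s * exp (- (b * x))\<close> over \<open>b\<close>; the next lemma repeats this once
  more to represent \<open>a powr (1 - s)\<close>.\<close>

lemma nn_integral_one_minus_exp_powr:
  fixes a s :: real
  assumes a: "a > 0" and s: "-1 < s" "s < 0"
  shows "(\<integral>\<^sup>+x. ennreal ((1 - exp (- (a * x))) * x powr (s - 1)) * indicator {0<..} x \<partial>lborel)
           = ennreal (- Gamma s * a powr (- s))"
proof -
  have "(\<integral>\<^sup>+x. ennreal ((1 - exp (- (a * x))) * x powr (s - 1)) * indicator {0<..} x \<partial>lborel)
     = ennreal (Gamma (s + 1) * a powr (1 - (s + 1)) / (1 - (s + 1)))"
  proof (rule nn_integral_parameter_integral[where g = "\<lambda>b x. x powr s * exp (- (b * x))"])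
    show "(\<integral>\<^sup>+x. ennreal (x powr s * exp (- (b * x))) * indicator {0<..} x \<partial>lborel) = ennreal (Gamma (s + 1) * b powr (- (s + 1)))"
      if "b > 0" for b
      using nn_integral_powr_exp[of b "s + 1"] that s by simp
    fix x :: real assume x: "x > 0"
    have "((\<lambda>b. x powr s * exp (- (b * x))) has_integral
        (- (x powr (s - 1)) * exp (- (a * x)) - - (x powr (s - 1)) * exp (- (0 * x)))) {0..a}"
      using a x by (intro fundamental_theorem_of_calculus)
        (auto intro!: derivative_eq_intros simp: powr_diff simp flip: has_real_derivative_iff_has_vector_derivative)
    then show "((\<lambda>b. x powr s * exp (- (b * x))) has_integral (1 - exp (- (a * x))) * x powr (s - 1)) {0..a}"
      by (simp add: algebra_simps)
  qed (use a s in \<open>auto intro: less_imp_le Gamma_real_pos\<close>)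
  also have "Gamma (s + 1) = s * Gamma s"
    using s by (intro Gamma_plus1) (auto elim!: nonpos_Ints_cases)
  finally show ?thesis using s by simp
qed

lemma nn_integral_exp_remainder_powr:
  fixes a s :: real
  assumes a: "a > 0" and s: "-1 < s" "s < 0"
  shows "(\<integral>\<^sup>+x. ennreal ((a * x - 1 + exp (- (a * x))) * x powr (s - 2)) * indicator {0<..} x \<partial>lborel)
           = ennreal (- Gamma s * a powr (1 - s) / (1 - s))"
proof (rule nn_integral_parameter_integral[where g = "\<lambda>b x. (1 - exp (- (b * x))) * x powr (s - 1)"])
  fix x :: real assume x: "x > 0"
  have "((\<lambda>b. (1 - exp (- (b * x))) * x powr (s - 1)) has_integral
      ((a * x + exp (- (a * x))) * x powr (s - 2) - (0 * x + exp (- (0 * x))) * x powr (s - 2))) {0..a}"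
    using a x by (intro fundamental_theorem_of_calculus)
      (auto intro!: derivative_eq_intros simp: powr_diff field_simps power2_eq_square simp flip: has_real_derivative_iff_has_vector_derivative)
  then show "((\<lambda>b. (1 - exp (- (b * x))) * x powr (s - 1)) has_integral (a * x - 1 + exp (- (a * x))) * x powr (s - 2)) {0..a}"
    by (simp add: algebra_simps)
next
  have "Gamma (s + 1) = s * Gamma s"
    using s by (intro Gamma_plus1) (auto elim!: nonpos_Ints_cases)
  moreover have "Gamma (s + 1) > 0" using s by (intro Gamma_real_pos) auto
  ultimately show "- Gamma s \<ge> 0" using s by (auto simp: zero_less_mult_iff)
qed (use nn_integral_one_minus_exp_powr a s in auto)

section \<open>The Mellin transform of the coth kernel\<close>

text \<open>This is \<open>coth (x / 2) / 2 - 1 / x\<close>. It vanishes to first order at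
  \<open>0\<close> and tends to \<open>1 / 2\<close> at infinity, so its Mellin transform converges
  exactly for \<open>-1 < s < 0\<close>.\<close>

definition coth_kernel :: "real \<Rightarrow> real" where
  "coth_kernel x = 1 / (exp x - 1) - 1 / x + 1 / 2"

lemma coth_kernel_nonneg: "x > 0 \<Longrightarrow> coth_kernel x \<ge> 0"
  unfolding coth_kernel_def by (rule sums_le[OF _ sums_zero coth_partial_fractions]) auto

text \<open>A geometric sum, arranged so that \<open>1 / (exp x - 1)\<close> occurs with the factor
  \<open>1 - exp (- (N + 1) * x)\<close> that it has in the truncated kernel.\<close>

lemma geometric_exp_sum:
  fixes x :: real
  assumes "x > 0"
  shows "(\<Sum>n<N. 1 - exp (- (real (Suc n) * x)))
           = real N + exp (- (real (Suc N) * x)) - (1 - exp (- (real (Suc N) * x))) / (exp x - 1)"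
proof (induction N)
  case 0
  have "exp x - 1 \<noteq> 0" using assms by simp
  then show ?case by (simp add: exp_minus field_simps)
next
  case (Suc N)
  have "exp x - 1 \<noteq> 0" using assms by simp
  moreover have "exp (- (real (Suc N) * x)) = exp x * exp (- (real (Suc (Suc N)) * x))"
    unfolding mult_exp_exp by (simp add: algebra_simps)
  ultimately show ?case unfolding sum.lessThan_Suc Suc.IH
    by (simp add: field_simps del: of_nat_Suc) (simp add: algebra_simps)
qed

text \<open>
  The Mellin transform is read off from \<open>zeta_limit_2\<close> by replacing each \<open>a powr (- s)\<close> by
  its integral representation: the partial sums then combine to the kernel times
  \<open>1 - exp (- (N + 1) * x)\<close>, and monotone convergence applies.
\<close>

lemma coth_kernel_mellin:
  fixes s :: real
  assumes s: "-1 < s" "s < 0"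
  shows "Gamma s * Re (zeta s) \<ge> 0"
    and "(\<integral>\<^sup>+x. ennreal (coth_kernel x * x powr (s - 1)) * indicator {0<..} x \<partial>lborel)
           = ennreal (Gamma s * Re (zeta s))"
proof -
  define u where "u = (\<lambda>a x. (1 - exp (- (a * x))) * x powr (s - 1) * indicator {0<..} x :: real)"
  define v where "v = (\<lambda>a x. (a * x - 1 + exp (- (a * x))) * x powr (s - 2) * indicator {0<..} x :: real)"
  define w where "w = (\<lambda>N x. (1 - exp (- (real (Suc N) * x))) * (coth_kernel x * x powr (s - 1)) * indicator {0<..} x)"
  define I where "I = (\<lambda>N. - Gamma s * real (Suc N) powr (1 - s) / (1 - s) - (- Gamma s * real (Suc N) powr (- s)) / 2
                 - (\<Sum>n<N. - Gamma s * real (Suc n) powr (- s)))"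
  have G: "- Gamma s \<ge> 0"
  proof -
    have "Gamma (s + 1) = s * Gamma s"
      using s by (intro Gamma_plus1) (auto elim!: nonpos_Ints_cases)
    moreover have "Gamma (s + 1) > 0" using s by (intro Gamma_real_pos) auto
    ultimately show "- Gamma s \<ge> 0" using s by (auto simp: zero_less_mult_iff)
  qed
  have iu: "has_bochner_integral lborel (u a) (- Gamma s * a powr (- s))" if "a > 0" for a
  proof (rule has_bochner_integral_nn_integral)
    show "(\<integral>\<^sup>+x. ennreal (u a x) \<partial>lborel) = ennreal (- Gamma s * a powr (- s))"
      unfolding u_def nn_integral_one_minus_exp_powr[OF that s, symmetric]
      by (intro nn_integral_cong) (auto simp: indicator_def)
    show "0 \<le> - Gamma s * a powr (- s)" using G by (intro mult_nonneg_nonneg) auto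
  qed (use that in \<open>auto simp: u_def indicator_def\<close>)
  have iv: "has_bochner_integral lborel (v a) (- Gamma s * a powr (1 - s) / (1 - s))" if "a > 0" for a
  proof (rule has_bochner_integral_nn_integral)
    show "(\<integral>\<^sup>+x. ennreal (v a x) \<partial>lborel) = ennreal (- Gamma s * a powr (1 - s) / (1 - s))"
      unfolding v_def nn_integral_exp_remainder_powr[OF that s, symmetric]
      by (intro nn_integral_cong) (auto simp: indicator_def)
    have "0 \<le> a * x - 1 + exp (- (a * x))" for x using exp_ge_add_one_self[of "- (a * x)"] by linarith
    then show "AE x in lborel. 0 \<le> v a x" by (auto simp: v_def indicator_def)
    show "0 \<le> - Gamma s * a powr (1 - s) / (1 - s)" using G s by (intro divide_nonneg_nonneg mult_nonneg_nonneg) auto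
  qed (use that in \<open>auto simp: v_def\<close>)
  \<comment> \<open>The combination mirrors the three terms of \<open>zeta_limit_2\<close>. With
    \<open>E = exp (- (N + 1) * x)\<close>, the multiples of \<open>N\<close> cancel, and the
    leftover \<open>1 - E\<close> minus half of itself yields the constant \<open>1 / 2\<close> of
    the kernel.\<close>
  have w_eq: "w N x = v (real (Suc N)) x - u (real (Suc N)) x / 2 - (\<Sum>n<N. u (real (Suc n)) x)" for N x
  proof (cases "x > 0")
    case True
    define E where "E = exp (- (real (Suc N) * x))"
    have "(\<Sum>n<N. u (real (Suc n)) x) = (\<Sum>n<N. 1 - exp (- (real (Suc n) * x))) * x powr (s - 1)"
      using True by (simp add: u_def sum_distrib_right)
    also have "\<dots> = (real N + E - (1 - E) / (exp x - 1)) * x powr (s - 1)"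
      unfolding geometric_exp_sum[OF True] E_def ..
    finally have su: "(\<Sum>n<N. u (real (Suc n)) x) = (real N + E - (1 - E) / (exp x - 1)) * x powr (s - 1)" .
    have "v (real (Suc N)) x = ((real N + 1) - (1 - E) / x) * x powr (s - 1)"
      using True by (simp add: v_def E_def powr_diff field_simps power2_eq_square)
    moreover have "u (real (Suc N)) x = (1 - E) * x powr (s - 1)"
      using True by (simp add: u_def E_def)
    moreover have "w N x = (1 - E) * (1 / (exp x - 1) - 1 / x + 1 / 2) * x powr (s - 1)"
      using True by (simp add: w_def E_def coth_kernel_def)
    ultimately show ?thesis unfolding su
      by (simp only:) (simp add: algebra_simps add_divide_distrib diff_divide_distrib)
  qed (simp add: w_def u_def v_def)
  have iw: "has_bochner_integral lborel (w N) (I N)" for N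
    unfolding w_eq I_def
    by (intro has_bochner_integral_diff has_bochner_integral_divide_zero has_bochner_integral_sum iu iv) auto
  have w0: "w N x \<ge> 0" for N x
    using coth_kernel_nonneg[of x] by (auto simp: w_def indicator_def intro!: mult_nonneg_nonneg)
  have I0: "I N \<ge> 0" for N
    using has_bochner_integral_integral_eq[OF iw[of N]] w0 by (metis Bochner_Integration.integral_nonneg)
  have nw: "(\<integral>\<^sup>+x. ennreal (w N x) \<partial>lborel) = ennreal (I N)" for N
    using iw[of N] w0 by (intro nn_integral_eq_integral[THEN trans]) (auto simp: has_bochner_integral_iff)
  \<comment> \<open>\<open>I\<close> is the sequence of \<open>zeta_limit_2\<close> multiplied by
    \<open>- Gamma s / (1 - s)\<close>.\<close>
  have limI: "I \<longlonglongrightarrow> Gamma s * Re (zeta s)"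
  proof -
    have 1: "(\<lambda>N. complex_of_real (real (Suc N) powr (1 - s) - (1 - s) * (\<Sum>n<N. real (Suc n) powr (- s))
              - (1 - s) / 2 * real (Suc N) powr (- s))) \<longlonglongrightarrow> (s - 1) * zeta s"
    proof -
      have e: "complex_of_nat (Suc n) powr (complex_of_real r) = complex_of_real (real (Suc n) powr r)" for n r
        by (subst powr_of_real[symmetric]) (auto simp del: of_nat_Suc)
      show ?thesis
        using zeta_limit_2[of "complex_of_real s"] s e[of _ "1 - s"] e[of _ "- s"]
        by (simp del: of_nat_Suc)
    qed
    have "(\<lambda>N. real (Suc N) powr (1 - s) - (1 - s) * (\<Sum>n<N. real (Suc n) powr (- s))
              - (1 - s) / 2 * real (Suc N) powr (- s)) \<longlonglongrightarrow> (s - 1) * Re (zeta s)"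
      using tendsto_Re[OF 1] by simp
    then have "(\<lambda>N. (- Gamma s / (1 - s)) * (real (Suc N) powr (1 - s) - (1 - s) * (\<Sum>n<N. real (Suc n) powr (- s))
              - (1 - s) / 2 * real (Suc N) powr (- s))) \<longlonglongrightarrow> (- Gamma s / (1 - s)) * ((s - 1) * Re (zeta s))"
      by (intro tendsto_mult tendsto_const)
    also have "(\<lambda>N. (- Gamma s / (1 - s)) * (real (Suc N) powr (1 - s) - (1 - s) * (\<Sum>n<N. real (Suc n) powr (- s))
              - (1 - s) / 2 * real (Suc N) powr (- s))) = I"
      using s by (intro ext) (simp add: I_def field_simps sum_distrib_left sum_negf del: of_nat_Suc)
    also have "(- Gamma s / (1 - s)) * ((s - 1) * Re (zeta s)) = Gamma s * Re (zeta s)"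
      using s by (simp add: field_simps)
    finally show ?thesis .
  qed
  show "Gamma s * Re (zeta s) \<ge> 0"
    using limI I0 by (intro LIMSEQ_le_const) auto
  have "(\<lambda>N. \<integral>\<^sup>+x. ennreal (w N x) \<partial>lborel) \<longlonglongrightarrow> (\<integral>\<^sup>+x. ennreal (coth_kernel x * x powr (s - 1)) * indicator {0<..} x \<partial>lborel)"
  proof (rule nn_integral_LIMSEQ)
    show "incseq (\<lambda>N x. ennreal (w N x))"
    proof (intro incseq_SucI le_funI ennreal_leI)
      fix N :: nat and x :: real
      show "w N x \<le> w (Suc N) x"
      proof (cases "x > 0")
        case True
        then show ?thesis unfolding w_def
          by (intro mult_right_mono mult_nonneg_nonneg coth_kernel_nonneg) auto
      qed (simp add: w_def)
    qed
    show "(\<lambda>x. ennreal (w N x)) \<in> borel_measurable lborel" for N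
      unfolding w_def coth_kernel_def by measurable
    fix x :: real
    show "(\<lambda>N. ennreal (w N x)) \<longlonglongrightarrow> ennreal (coth_kernel x * x powr (s - 1)) * indicator {0<..} x"
    proof (cases "x > 0")
      case True
      have "(\<lambda>N. exp (- (real (Suc N) * x))) = (\<lambda>N. exp (- x) ^ Suc N)"
        by (simp only: exp_of_nat_mult[symmetric] mult_minus_right)
      moreover have "(\<lambda>N. exp (- x) ^ Suc N) \<longlonglongrightarrow> 0"
        using True by (intro LIMSEQ_Suc LIMSEQ_realpow_zero) auto
      ultimately have "(\<lambda>N. exp (- (real (Suc N) * x))) \<longlonglongrightarrow> 0" by simp
      then have "(\<lambda>N. w N x) \<longlonglongrightarrow> (1 - 0) * (coth_kernel x * x powr (s - 1)) * indicator {0<..} x"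
        unfolding w_def by (intro tendsto_intros)
      then show ?thesis using True by (simp add: tendsto_ennrealI)
    qed (simp add: w_def)
  qed
  moreover have "(\<lambda>N. \<integral>\<^sup>+x. ennreal (w N x) \<partial>lborel) \<longlonglongrightarrow> ennreal (Gamma s * Re (zeta s))"
    unfolding nw by (intro tendsto_ennrealI limI)
  ultimately show "(\<integral>\<^sup>+x. ennreal (coth_kernel x * x powr (s - 1)) * indicator {0<..} x \<partial>lborel)
           = ennreal (Gamma s * Re (zeta s))"
    by (rule LIMSEQ_unique)
qed

section \<open>The functional equation, from a real interval to the complex plane\<close>

lemma nn_integral_powr_over_square_plus_square:
  fixes c s :: real
  assumes c: "c > 0" and s: "-1 < s" "s < 1"
  shows "(\<integral>\<^sup>+x. ennreal (x powr s / (x\<^sup>2 + c\<^sup>2)) * indicator {0<..} x \<partial>lborel)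
          = ennreal (c powr (s - 1) * (Gamma ((1 + s) / 2) * Gamma ((1 - s) / 2) / 2))"
proof -
  have "(\<integral>\<^sup>+x. ennreal (x powr s / (x\<^sup>2 + c\<^sup>2)) * indicator {0<..} x \<partial>lborel)
     = ennreal \<bar>c\<bar> * (\<integral>\<^sup>+x. ennreal ((0 + c * x) powr s / ((0 + c * x)\<^sup>2 + c\<^sup>2)) * indicator {0<..} (0 + c * x) \<partial>lborel)"
    using c by (intro nn_integral_real_affine) auto
  also have "(\<integral>\<^sup>+x. ennreal ((0 + c * x) powr s / ((0 + c * x)\<^sup>2 + c\<^sup>2)) * indicator {0<..} (0 + c * x) \<partial>lborel)
     = (\<integral>\<^sup>+x. ennreal (c powr (s - 2)) * (ennreal (x powr s / (1 + x\<^sup>2)) * indicator {0<..} x) \<partial>lborel)"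
  proof (intro nn_integral_cong)
    fix x :: real
    have "(c * x) powr s / ((c * x)\<^sup>2 + c\<^sup>2) = c powr (s - 2) * (x powr s / (1 + x\<^sup>2))" if "x > 0"
    proof -
      have "(c * x)\<^sup>2 + c\<^sup>2 = c\<^sup>2 * (1 + x\<^sup>2)" by (simp add: algebra_simps power2_eq_square)
      then show ?thesis using c that by (simp add: powr_mult powr_diff)
    qed
    then show "ennreal ((0 + c * x) powr s / ((0 + c * x)\<^sup>2 + c\<^sup>2)) * indicator {0<..} (0 + c * x)
      = ennreal (c powr (s - 2)) * (ennreal (x powr s / (1 + x\<^sup>2)) * indicator {0<..} x)"
      using c by (cases "x > 0") (auto simp: zero_less_mult_iff simp flip: ennreal_mult)
  qed
  also have "\<dots> = ennreal (c powr (s - 2)) * ennreal (Gamma ((1 + s) / 2) * Gamma ((1 - s) / 2) / 2)"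
    by (subst nn_integral_cmult) (auto simp: nn_integral_powr_over_one_plus_square[OF s])
  also have "ennreal \<bar>c\<bar> * \<dots> = ennreal (c powr (s - 1) * (Gamma ((1 + s) / 2) * Gamma ((1 - s) / 2) / 2))"
  proof -
    have "Gamma ((1 + s) / 2) > 0" "Gamma ((1 - s) / 2) > 0" using s by (auto intro!: Gamma_real_pos)
    moreover have "c * c powr (s - 2) = c powr (s - 1)" using c by (simp add: powr_diff power2_eq_square)
    ultimately show ?thesis using c by (simp flip: ennreal_mult mult.assoc)
  qed
  finally show ?thesis .
qed

lemma Re_zeta_sums:
  fixes s :: real
  assumes "s < 0"
  shows "(\<lambda>n. real (Suc n) powr (s - 1)) sums Re (zeta (1 - s))"
proof -
  have "(\<lambda>n. 1 / of_nat (Suc n) powr (complex_of_real (1 - s))) sums zeta (1 - s)"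
    using assms by (subst zeta_eq_series) (auto simp del: of_nat_Suc intro!: summable_sums zeta_series_summable)
  moreover have "1 / of_nat (Suc n) powr (complex_of_real (1 - s)) = complex_of_real (real (Suc n) powr (s - 1))" for n
  proof -
    have "of_nat (Suc n) powr (complex_of_real (1 - s)) = complex_of_real (real (Suc n) powr (1 - s))"
      by (subst powr_of_real[symmetric]) (auto simp del: of_nat_Suc)
    then show ?thesis by (simp add: powr_diff del: of_nat_Suc)
  qed
  ultimately have "(\<lambda>n. complex_of_real (real (Suc n) powr (s - 1))) sums zeta (1 - s)" by simp
  from sums_Re[OF this] show ?thesis by simp
qed

text \<open>Two evaluations of the Mellin transform of \<open>coth_kernel\<close>: one is
  \<open>coth_kernel_mellin\<close>, the other integrates the partial fraction expansion term by
  term, which produces the Dirichlet series at \<open>1 - s\<close>.\<close>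

lemma zeta_functional_equation_real:
  fixes s :: real
  assumes s: "-1 < s" "s < 0"
  shows "Gamma s * Re (zeta s) = (2 * pi) powr (s - 1) * (Gamma ((1 + s) / 2) * Gamma ((1 - s) / 2)) * Re (zeta (1 - s))"
proof -
  define \<kappa> where "\<kappa> = Gamma ((1 + s) / 2) * Gamma ((1 - s) / 2) / 2"
  have k0: "\<kappa> > 0" unfolding \<kappa>_def using s by (auto intro!: Gamma_real_pos)
  define f where "f = (\<lambda>n x. 2 * (x powr s / (x\<^sup>2 + (2 * pi * real (Suc n))\<^sup>2)))"
  have "ennreal (Gamma s * Re (zeta s)) = (\<integral>\<^sup>+x. (\<Sum>n. ennreal (f n x) * indicator {0<..} x) \<partial>lborel)"
    unfolding coth_kernel_mellin(2)[OF s, symmetric]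
  proof (intro nn_integral_cong)
    fix x :: real
    show "ennreal (coth_kernel x * x powr (s - 1)) * indicator {0<..} x = (\<Sum>n. ennreal (f n x) * indicator {0<..} x)"
    proof (cases "x > 0")
      case True
      have "(\<lambda>n. 2 * x / (x\<^sup>2 + (2 * pi * real (Suc n))\<^sup>2) * x powr (s - 1)) sums (coth_kernel x * x powr (s - 1))"
        unfolding coth_kernel_def by (intro sums_mult2 coth_partial_fractions True)
      also have "(\<lambda>n. 2 * x / (x\<^sup>2 + (2 * pi * real (Suc n))\<^sup>2) * x powr (s - 1)) = (\<lambda>n. f n x)"
        using True by (intro ext) (simp add: f_def powr_diff)
      finally have "(\<Sum>n. ennreal (f n x)) = ennreal (coth_kernel x * x powr (s - 1))"
        by (intro suminf_ennreal_eq) (auto simp: f_def)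
      then show ?thesis using True by simp
    qed simp
  qed
  also have "\<dots> = (\<Sum>n. \<integral>\<^sup>+x. ennreal (f n x) * indicator {0<..} x \<partial>lborel)"
    unfolding f_def by (intro nn_integral_suminf) measurable
  also have "\<dots> = (\<Sum>n. ennreal (2 * (2 * pi) powr (s - 1) * \<kappa> * real (Suc n) powr (s - 1)))"
  proof (intro suminf_cong)
    fix n
    have "(\<integral>\<^sup>+x. ennreal (f n x) * indicator {0<..} x \<partial>lborel)
       = (\<integral>\<^sup>+x. 2 * (ennreal (x powr s / (x\<^sup>2 + (2 * pi * real (Suc n))\<^sup>2)) * indicator {0<..} x) \<partial>lborel)"
      unfolding f_def by (intro nn_integral_cong) (subst ennreal_mult, auto simp: mult.assoc simp del: of_nat_Suc)
    also have "\<dots> = 2 * ennreal ((2 * pi * real (Suc n)) powr (s - 1) * \<kappa>)"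
      using s by (subst nn_integral_cmult) (auto simp: nn_integral_powr_over_square_plus_square \<kappa>_def simp del: of_nat_Suc)
    also have "\<dots> = ennreal (2 * (2 * pi) powr (s - 1) * \<kappa> * real (Suc n) powr (s - 1))"
    proof -
      have "2 * (2 * pi) powr (s - 1) * \<kappa> * real (Suc n) powr (s - 1) = 2 * ((2 * pi * real (Suc n)) powr (s - 1) * \<kappa>)"
        by (simp add: powr_mult del: of_nat_Suc)
      then show ?thesis using k0 by (simp only:) (subst ennreal_mult[of 2], auto)
    qed
    finally show "(\<integral>\<^sup>+x. ennreal (f n x) * indicator {0<..} x \<partial>lborel)
       = ennreal (2 * (2 * pi) powr (s - 1) * \<kappa> * real (Suc n) powr (s - 1))" .
  qed
  also have "\<dots> = ennreal (2 * (2 * pi) powr (s - 1) * \<kappa> * Re (zeta (1 - s)))"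
    using k0 s by (intro suminf_ennreal_eq sums_mult Re_zeta_sums) (auto simp del: of_nat_Suc)
  finally have "ennreal (Gamma s * Re (zeta s)) = ennreal (2 * (2 * pi) powr (s - 1) * \<kappa> * Re (zeta (1 - s)))" .
  \<comment> \<open>Both values must be known to be nonnegative before the equation in
    \<open>ennreal\<close> becomes one between reals.\<close>
  moreover have "Re (zeta (1 - s)) \<ge> 0"
    by (rule sums_le[OF _ sums_zero Re_zeta_sums]) (use s in auto)
  ultimately show ?thesis
    using coth_kernel_mellin(1)[OF s] k0 by (simp add: ennreal_inj \<kappa>_def)
qed

text \<open>The conjugated function has the properties that characterize \<open>zeta\<close>, so
  uniqueness of the continuation applies.\<close>

lemma zeta_cnj: "zeta (cnj s) = cnj (zeta s)"
proof -
  define f where "f = (\<lambda>s. cnj (zeta (cnj s)))"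
  have f: "f holomorphic_on - {1} \<and> (\<forall>s. Re s > 1 \<longrightarrow> f s = (\<Sum>n. 1 / of_nat (Suc n) powr s)) \<and> f 1 = 0"
  proof (intro conjI allI impI)
    have "(cnj \<circ> zeta \<circ> cnj) holomorphic_on - {1}"
      by (intro holomorphic_on_compose_cnj_cnj holomorphic_on_subset[OF zeta_holomorphic]) auto
    then show "f holomorphic_on - {1}" by (simp add: f_def o_def)
    fix s assume s: "Re s > 1"
    have "f s = cnj (\<Sum>n. 1 / of_nat (Suc n) powr (cnj s))"
      using s by (simp add: f_def zeta_eq_series)
    also have "\<dots> = (\<Sum>n. cnj (1 / of_nat (Suc n) powr (cnj s)))"
      using s zeta_series_summable[of "cnj s"] by (intro bounded_linear.suminf[OF bounded_linear_cnj]) auto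
    also have "\<dots> = (\<Sum>n. 1 / of_nat (Suc n) powr s)"
      by (intro suminf_cong) (simp add: cnj_powr del: of_nat_Suc)
    finally show "f s = (\<Sum>n. 1 / of_nat (Suc n) powr s)" .
  qed (simp add: f_def zeta_1)
  then have "f = zeta" unfolding zeta_def by (intro the1_equality[OF zeta_continuation_ex1, symmetric])
  from fun_cong[OF this, of "cnj s"] show ?thesis by (simp add: f_def)
qed

lemma zeta_of_real: "zeta (of_real x) = of_real (Re (zeta (of_real x)))"
  using zeta_cnj[of "of_real x"] by (simp add: complex_eq_iff)

text \<open>Legendre duplication replaces \<open>Gamma s\<close>, and the factor
  \<open>Gamma ((1 + s) / 2)\<close> cancels. The symmetric form is written with the entire function
  \<open>rGamma\<close>, so that no poles obstruct its continuation.\<close>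

lemma zeta_functional_equation_negative:
  fixes s :: real
  assumes s: "-1 < s" "s < 0"
  shows "rGamma ((1 - of_real s) / 2) * zeta (of_real s)
         = of_real pi powr (of_real s - 1 / 2) * rGamma (of_real s / 2) * zeta (1 - of_real s)"
proof -
  have nonpos: "x \<notin> \<int>\<^sub>\<le>\<^sub>0" if "x > -1" "x \<noteq> 0" for x :: real
  proof
    assume "x \<in> \<int>\<^sub>\<le>\<^sub>0"
    then obtain n where "x = of_int n" "n \<le> 0" by (elim nonpos_Ints_cases)
    with that show False by simp
  qed
  have n: "s / 2 \<notin> \<int>\<^sub>\<le>\<^sub>0" "s / 2 + 1 / 2 \<notin> \<int>\<^sub>\<le>\<^sub>0" "(1 - s) / 2 \<notin> \<int>\<^sub>\<le>\<^sub>0"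
    by (rule nonpos; use s in simp)+
  then have nz: "Gamma (s / 2) \<noteq> 0" "Gamma (s / 2 + 1 / 2) \<noteq> 0" "Gamma ((1 - s) / 2) \<noteq> 0"
    by (auto simp: Gamma_eq_zero_iff)
  have "complex_of_real (Gamma (s / 2) * Gamma (s / 2 + 1 / 2)) = complex_of_real (exp ((1 - s) * ln 2) * sqrt pi * Gamma s)"
  proof -
    have "complex_of_real (s / 2) \<notin> \<int>\<^sub>\<le>\<^sub>0" "complex_of_real (s / 2 + 1 / 2) \<notin> \<int>\<^sub>\<le>\<^sub>0"
      unfolding of_real_in_nonpos_Ints_iff using n by auto
    with Gamma_legendre_duplication[of "complex_of_real (s / 2)"] show ?thesis
      by (simp flip: Gamma_complex_of_real exp_of_real)
  qed
  then have leg: "Gamma (s / 2) * Gamma (s / 2 + 1 / 2) = exp ((1 - s) * ln 2) * sqrt pi * Gamma s"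
    by (simp only: of_real_eq_iff)
  define a where "a = Re (zeta (of_real s))"
  define b where "b = Re (zeta (of_real (1 - s)))"
  have "Gamma s * a = (2 * pi) powr (s - 1) * (Gamma (s / 2 + 1 / 2) * Gamma ((1 - s) / 2)) * b"
    using zeta_functional_equation_real[OF s] by (simp add: a_def b_def add_divide_distrib add.commute)
  then have "Gamma (s / 2) * Gamma (s / 2 + 1 / 2) * a
     = exp ((1 - s) * ln 2) * sqrt pi * (2 * pi) powr (s - 1) * (Gamma (s / 2 + 1 / 2) * Gamma ((1 - s) / 2)) * b"
    unfolding leg by simp
  then have "Gamma (s / 2) * a = (exp ((1 - s) * ln 2) * sqrt pi * (2 * pi) powr (s - 1)) * Gamma ((1 - s) / 2) * b"
    using nz by simp
  also have "exp ((1 - s) * ln 2) * sqrt pi * (2 * pi) powr (s - 1) = pi powr (s - 1 / 2)"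
  proof -
    have "exp ((1 - s) * ln 2) = 2 powr (1 - s)" by (simp add: powr_def)
    moreover have "(2 * pi) powr (s - 1) = 2 powr (s - 1) * pi powr (s - 1)" by (simp add: powr_mult)
    moreover have "2 powr (1 - s) * 2 powr (s - 1) = (1 :: real)" by (simp flip: powr_add)
    moreover have "sqrt pi * pi powr (s - 1) = pi powr (s - 1 / 2)"
      by (simp add: powr_half_sqrt[symmetric] flip: powr_add)
    ultimately show ?thesis by (metis mult.assoc mult.left_commute mult.right_neutral)
  qed
  finally have "a / Gamma ((1 - s) / 2) = pi powr (s - 1 / 2) * (b / Gamma (s / 2))"
    using nz by (simp add: field_simps)
  then have "complex_of_real (rGamma ((1 - s) / 2) * a) = of_real (pi powr (s - 1 / 2) * rGamma (s / 2) * b)"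
    by (simp add: rGamma_inverse_Gamma field_simps)
  moreover have "complex_of_real (pi powr (s - 1 / 2)) = of_real pi powr (of_real s - 1 / 2)"
    using powr_of_real[of pi "s - 1 / 2"] by simp
  moreover have "zeta (of_real s) = of_real a" "zeta (1 - of_real s) = of_real b"
    using zeta_of_real[of s] zeta_of_real[of "1 - s"] by (simp_all add: a_def b_def)
  ultimately show ?thesis by (simp flip: rGamma_complex_of_real)
qed

text \<open>Both sides are holomorphic away from \<open>0\<close> and \<open>1\<close> and agree on
  the real segment between \<open>-1\<close> and \<open>0\<close>, which has the limit point
  \<open>-1/2\<close>; the identity theorem does the rest.\<close>

theorem zeta_functional_equation:
  assumes s: "s \<noteq> 0" "s \<noteq> 1"
  shows "rGamma ((1 - s) / 2) * zeta s = of_real pi powr (s - 1 / 2) * rGamma (s / 2) * zeta (1 - s)"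
proof -
  define f where "f = (\<lambda>s. rGamma ((1 - s) / 2) * zeta s - of_real pi powr (s - 1 / 2) * rGamma (s / 2) * zeta (1 - s))"
  define U :: "complex set" where "U = of_real ` {-1<..<0}"
  have "f s = 0"
  proof (rule analytic_continuation[of f "- {0, 1}" U "of_real (-1/2)"])
    have "zeta holomorphic_on - {0, 1}" by (rule holomorphic_on_subset[OF zeta_holomorphic]) auto
    moreover have "(\<lambda>s. zeta (1 - s)) holomorphic_on - {0, 1}"
      by (rule holomorphic_on_compose_gen[OF _ zeta_holomorphic, unfolded o_def]) (auto intro!: holomorphic_intros)
    ultimately show "f holomorphic_on - {0, 1}"
      unfolding f_def by (intro holomorphic_intros) auto
    show "connected (- {0, 1 :: complex})"
      by (intro connected_open_diff_countable[of UNIV, unfolded Compl_eq_Diff_UNIV[symmetric]]) auto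
    show "complex_of_real (-1/2) islimpt U"
    proof -
      have "(-1/2 :: real) islimpt {-1<..<0}" by (intro open_imp_islimpt) auto
      then show ?thesis unfolding U_def
      proof (rule islimpt_isCont_image)
        show "\<forall>\<^sub>F x in at (-1/2). complex_of_real x \<noteq> complex_of_real (-1/2)"
          unfolding of_real_eq_iff by (rule eventually_neq_at_within)
      qed auto
    qed
    show "U \<subseteq> - {0, 1}" by (auto simp: U_def)
    show "f z = 0" if "z \<in> U" for z
      using that zeta_functional_equation_negative by (auto simp: U_def f_def)
  qed (use s in \<open>auto simp: complex_eq_iff\<close>)
  then show ?thesis by (simp add: f_def)
qed

subsection \<open>The holomorphic extension of Hardy's function\<close>

text \<open>By Euler's limit, \<open>cmod (Gamma (Complex x t)) / Gamma x\<close> is a limit of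
  products of the ratios \<open>(x + k) / cmod (Complex x t + k)\<close>, each of which increases
  with \<open>x > 0\<close>.\<close>

lemma norm_Gamma_vertical_ratio_mono:
  fixes x y t :: real
  assumes x: "0 < x" and xy: "x \<le> y"
  shows "cmod (Gamma (Complex x t)) * Gamma y \<le> cmod (Gamma (Complex y t)) * Gamma x"
proof -
  have norm_series: "cmod (Gamma_series (Complex u t) n) = fact n * exp (u * ln (real n)) / (\<Prod>k<Suc n. cmod (Complex u t + of_nat k))"
    for u n
  proof -
    have "cmod (pochhammer (Complex u t) (n + 1)) = (\<Prod>k<Suc n. cmod (Complex u t + of_nat k))"
      unfolding pochhammer_prod by (simp add: prod_norm atLeast0LessThan del: prod.lessThan_Suc)
    then show ?thesis
      by (simp add: Gamma_series_def norm_divide norm_mult norm_exp_eq_Re del: prod.lessThan_Suc)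
  qed
  have real_series: "Gamma_series u n = fact n * exp (u * ln (real n)) / (\<Prod>k<Suc n. u + real k)" for u n
    by (simp add: Gamma_series_def pochhammer_prod atLeast0LessThan del: prod.lessThan_Suc)
  have "cmod (Gamma_series (Complex x t) n) * Gamma_series y n \<le> cmod (Gamma_series (Complex y t) n) * Gamma_series x n" for n
  proof -
    define P Q P' Q' where "P = (\<Prod>k<Suc n. cmod (Complex x t + of_nat k))" and "Q = (\<Prod>k<Suc n. cmod (Complex y t + of_nat k))"
      and "P' = (\<Prod>k<Suc n. x + real k)" and "Q' = (\<Prod>k<Suc n. y + real k)"
    have pos: "P > 0" "Q > 0" "P' > 0" "Q' > 0"
      unfolding P_def Q_def P'_def Q'_def using x xy by (auto intro!: prod_pos simp: complex_eq_iff simp del: prod.lessThan_Suc)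
    have "Q * P' = (\<Prod>k<Suc n. cmod (Complex y t + of_nat k) * (x + real k))"
      unfolding Q_def P'_def by (rule prod.distrib[symmetric])
    also have "\<dots> \<le> (\<Prod>k<Suc n. cmod (Complex x t + of_nat k) * (y + real k))"
    proof (intro prod_mono conjI)
      fix k
      define a b where "a = x + real k" and "b = y + real k"
      have ab: "0 < a" "a \<le> b" using x xy by (auto simp: a_def b_def)
      have "(b\<^sup>2 + t\<^sup>2) * a\<^sup>2 \<le> (a\<^sup>2 + t\<^sup>2) * b\<^sup>2"
      proof -
        have "t\<^sup>2 * a\<^sup>2 \<le> t\<^sup>2 * b\<^sup>2" using ab by (intro mult_left_mono power_mono) auto
        then show ?thesis by (simp add: algebra_simps)
      qed
      then have "sqrt ((b\<^sup>2 + t\<^sup>2) * a\<^sup>2) \<le> sqrt ((a\<^sup>2 + t\<^sup>2) * b\<^sup>2)" by (rule real_sqrt_le_mono)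
      then show "cmod (Complex y t + of_nat k) * (x + real k) \<le> cmod (Complex x t + of_nat k) * (y + real k)"
        using ab by (simp add: cmod_def real_sqrt_mult a_def b_def)
      show "0 \<le> cmod (Complex y t + of_nat k) * (x + real k)" using x by simp
    qed
    also have "\<dots> = P * Q'" unfolding P_def Q'_def by (rule prod.distrib)
    finally have PQ: "Q * P' \<le> P * Q'" .
    have "fact n * exp (x * ln (real n)) / P * (fact n * exp (y * ln (real n)) / Q')
        = (fact n * exp (x * ln (real n)) * (fact n * exp (y * ln (real n)))) / (P * Q')" by simp
    also have "\<dots> \<le> (fact n * exp (x * ln (real n)) * (fact n * exp (y * ln (real n)))) / (Q * P')"
      using PQ pos by (intro divide_left_mono) auto
    also have "\<dots> = fact n * exp (y * ln (real n)) / Q * (fact n * exp (x * ln (real n)) / P')" by simp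
    finally show ?thesis unfolding norm_series real_series P_def Q_def P'_def Q'_def .
  qed
  moreover have "(\<lambda>n. cmod (Gamma_series (Complex x t) n) * Gamma_series y n) \<longlonglongrightarrow> cmod (Gamma (Complex x t)) * Gamma y"
    by (intro tendsto_intros Gamma_series_LIMSEQ)
  moreover have "(\<lambda>n. cmod (Gamma_series (Complex y t) n) * Gamma_series x n) \<longlonglongrightarrow> cmod (Gamma (Complex y t)) * Gamma x"
    by (intro tendsto_intros Gamma_series_LIMSEQ)
  ultimately show ?thesis by (intro LIMSEQ_le) auto
qed

text \<open>From \<open>3 / 2\<close> on the real Gamma function is increasing, so the monotonicity
  of the ratio passes to the modulus itself.\<close>

lemma norm_Gamma_vertical_mono:
  fixes x y t :: real
  assumes x: "3 / 2 \<le> x" and xy: "x \<le> y"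
  shows "cmod (Gamma (Complex x t)) \<le> cmod (Gamma (Complex y t))"
proof -
  have "cmod (Gamma (Complex x t)) * Gamma y \<le> cmod (Gamma (Complex y t)) * Gamma x"
    using x xy by (intro norm_Gamma_vertical_ratio_mono) auto
  also have "Gamma x \<le> Gamma y" using Gamma_real_strict_mono[of x y] x xy by (cases "x = y") auto
  finally show ?thesis using Gamma_real_pos[of y] x xy by (auto simp: mult_le_cancel_right mult_left_mono)
qed

text \<open>Two applications of \<open>Gamma (z + 1) = z * Gamma z\<close> with
  \<open>cmod z \<ge> 1\<close>. The shift by \<open>2\<close> moves small positive real parts into
  the range of the preceding lemma.\<close>

lemma norm_Gamma_le_plus_2:
  assumes "\<bar>t\<bar> \<ge> 1"
  shows "cmod (Gamma (Complex x t)) \<le> cmod (Gamma (Complex (x + 2) t))"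
proof -
  have ge: "cmod (Complex u t) \<ge> 1" for u using abs_Im_le_cmod[of "Complex u t"] assms by simp
  have z: "Complex u t \<notin> \<int>\<^sub>\<le>\<^sub>0" for u
    using assms by (auto simp: complex_eq_iff elim!: nonpos_Ints_cases)
  have step: "cmod (Gamma (Complex u t)) \<le> cmod (Gamma (Complex (u + 1) t))" for u
  proof -
    have "Complex (u + 1) t = Complex u t + 1" by (simp add: complex_eq_iff)
    then have "cmod (Gamma (Complex (u + 1) t)) = cmod (Complex u t) * cmod (Gamma (Complex u t))"
      by (simp only: Gamma_plus1[OF z] norm_mult)
    moreover have "1 * cmod (Gamma (Complex u t)) \<le> cmod (Complex u t) * cmod (Gamma (Complex u t))"
      using ge by (intro mult_right_mono) auto
    ultimately show ?thesis by simp
  qed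
  have "x + 1 + 1 = x + 2" by simp
  then show ?thesis using step[of x] step[of "x + 1"] by (metis order.trans)
qed

text \<open>Every principal logarithm in \<open>ln_Gamma_series\<close> has its argument off the
  negative axis and hence commutes with conjugation; the identity survives the limit.\<close>

lemma cnj_ln_Gamma:
  fixes z :: complex
  assumes z: "z \<notin> \<real>\<^sub>\<le>\<^sub>0"
  shows "cnj (ln_Gamma z) = ln_Gamma (cnj z)"
proof (rule LIMSEQ_unique)
  have cz: "cnj z \<notin> \<real>\<^sub>\<le>\<^sub>0" using z by (auto simp: complex_nonpos_Reals_iff)
  have notint: "w \<notin> \<int>\<^sub>\<le>\<^sub>0" if "w \<notin> \<real>\<^sub>\<le>\<^sub>0" for w :: complex
    using that nonpos_Ints_subset_nonpos_Reals by blast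
  show "(\<lambda>n. cnj (ln_Gamma_series z n)) \<longlonglongrightarrow> cnj (ln_Gamma z)"
    by (intro tendsto_cnj ln_Gamma_complex_LIMSEQ notint z)
  have "cnj (ln_Gamma_series z n) = ln_Gamma_series (cnj z) n" if "n > 0" for n
  proof -
    have "cnj (ln (z / of_nat k + 1)) = ln (cnj z / of_nat k + 1)" if "k \<in> {1..n}" for k
    proof -
      have k: "real k \<ge> 1" using that by simp
      have "z / of_nat k + 1 \<notin> \<real>\<^sub>\<le>\<^sub>0"
        using z k by (auto simp: complex_nonpos_Reals_iff Re_divide_of_nat Im_divide_of_nat field_simps)
      then show ?thesis by (simp add: cnj_Ln)
    qed
    moreover have "cnj (ln (of_nat n)) = ln (of_nat n :: complex)"
      using that by (simp add: cnj_Ln complex_nonpos_Reals_iff)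
    ultimately show ?thesis unfolding ln_Gamma_series_def using z by (simp add: cnj_Ln)
  qed
  then have "\<forall>\<^sub>F n in sequentially. ln_Gamma_series (cnj z) n = cnj (ln_Gamma_series z n)"
    by (intro eventually_mono[OF eventually_gt_at_top[of 0]]) simp
  then show "(\<lambda>n. cnj (ln_Gamma_series z n)) \<longlonglongrightarrow> ln_Gamma (cnj z)"
    by (rule Lim_transform_eventually[OF ln_Gamma_complex_LIMSEQ[OF notint[OF cz]]])
qed

section \<open>Construction of the extension and its values on the real axis\<close>

text \<open>For real \<open>z\<close> the two \<open>ln_Gamma\<close> values are conjugate, so half
  their difference is \<open>\<i>\<close> times the argument of the Gamma value. Written this way,
  \<open>exp (\<i> * theta)\<close> makes sense for complex \<open>z\<close> and is holomorphic
  where \<open>Re z > 0\<close>.\<close>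

definition hardy_phase :: "complex \<Rightarrow> complex" where
  "hardy_phase z = exp ((ln_Gamma (1 / 4 + \<i> * z / 2) - ln_Gamma (1 / 4 - \<i> * z / 2)) / 2 - \<i> * z / 2 * of_real (ln pi))"

definition hardy_ext :: "complex \<Rightarrow> complex" where
  "hardy_ext z = hardy_phase z * zeta (1 / 2 + \<i> * z)"

lemma hardy_arg_not_nonpos:
  assumes "Re z \<noteq> 0"
  shows "1 / 4 + \<i> * z / 2 \<notin> \<real>\<^sub>\<le>\<^sub>0" "1 / 4 - \<i> * z / 2 \<notin> \<real>\<^sub>\<le>\<^sub>0"
        "1 / 4 + \<i> * z / 2 \<notin> \<int>\<^sub>\<le>\<^sub>0" "1 / 4 - \<i> * z / 2 \<notin> \<int>\<^sub>\<le>\<^sub>0"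
proof -
  show *: "1 / 4 + \<i> * z / 2 \<notin> \<real>\<^sub>\<le>\<^sub>0" "1 / 4 - \<i> * z / 2 \<notin> \<real>\<^sub>\<le>\<^sub>0"
    using assms by (auto simp: complex_nonpos_Reals_iff)
  show "1 / 4 + \<i> * z / 2 \<notin> \<int>\<^sub>\<le>\<^sub>0" "1 / 4 - \<i> * z / 2 \<notin> \<int>\<^sub>\<le>\<^sub>0"
    using * nonpos_Ints_subset_nonpos_Reals by blast+
qed

text \<open>Squaring removes the halved logarithms and leaves the Gamma quotient of the functional
  equation, from which sizes can be read off.\<close>

lemma hardy_phase_square:
  assumes "Re z \<noteq> 0"
  shows "hardy_phase z ^ 2 = of_real pi powr (- (\<i> * z)) * Gamma (1 / 4 + \<i> * z / 2) * rGamma (1 / 4 - \<i> * z / 2)"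
proof -
  note n = hardy_arg_not_nonpos[OF assms]
  have "hardy_phase z ^ 2 = exp (ln_Gamma (1 / 4 + \<i> * z / 2) - ln_Gamma (1 / 4 - \<i> * z / 2) - \<i> * z * of_real (ln pi))"
    unfolding hardy_phase_def exp_double[symmetric] by (rule arg_cong[of _ _ exp]) (simp add: field_simps)
  also have "\<dots> = exp (ln_Gamma (1 / 4 + \<i> * z / 2)) / exp (ln_Gamma (1 / 4 - \<i> * z / 2)) * exp (- (\<i> * z * of_real (ln pi)))"
    by (simp only: exp_diff exp_minus divide_inverse)
  also have "exp (- (\<i> * z * of_real (ln pi))) = of_real pi powr (- (\<i> * z))"
    by (simp add: powr_def Ln_of_real)
  also have "exp (ln_Gamma (1 / 4 + \<i> * z / 2)) = Gamma (1 / 4 + \<i> * z / 2)"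
    using n(3) by (simp only: Gamma_complex_altdef if_False)
  also have "exp (ln_Gamma (1 / 4 - \<i> * z / 2)) = Gamma (1 / 4 - \<i> * z / 2)"
    using n(4) by (simp only: Gamma_complex_altdef if_False)
  finally show ?thesis by (simp only: rGamma_inverse_Gamma divide_inverse mult_ac)
qed

lemma hardy_phase_cnj:
  assumes "Re z \<noteq> 0"
  shows "hardy_phase (cnj z) * cnj (hardy_phase z) = 1"
proof -
  note n = hardy_arg_not_nonpos[OF assms]
  have "cnj (ln_Gamma (1 / 4 + \<i> * z / 2)) = ln_Gamma (1 / 4 - \<i> * cnj z / 2)"
       "cnj (ln_Gamma (1 / 4 - \<i> * z / 2)) = ln_Gamma (1 / 4 + \<i> * cnj z / 2)"
    using n by (simp_all add: cnj_ln_Gamma)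
  then show ?thesis
    unfolding hardy_phase_def exp_cnj mult_exp_exp by (simp add: field_simps)
qed

text \<open>The functional equation says \<open>hardy_phase w ^ 2 * zeta (1 / 2 + \<i> * w) = zeta
  (1 / 2 - \<i> * w)\<close>. One phase factor is moved to the other side by
  \<open>hardy_phase_cnj\<close>. For real arguments this gives the reality of Hardy's
  function.\<close>

lemma hardy_ext_cnj:
  assumes z: "Re z \<noteq> 0"
  shows "hardy_ext (cnj z) = cnj (hardy_ext z)"
proof -
  define w where "w = cnj z"
  have w: "Re w \<noteq> 0" using z by (simp add: w_def)
  note n = hardy_arg_not_nonpos[OF w]
  have G: "Gamma (1 / 4 + \<i> * w / 2) * rGamma (1 / 4 + \<i> * w / 2) = 1"
    using n by (simp add: rGamma_inverse_Gamma Gamma_eq_zero_iff)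
  have "1 / 2 + \<i> * w \<noteq> 0" "1 / 2 + \<i> * w \<noteq> 1" using w by (auto simp: complex_eq_iff)
  from zeta_functional_equation[OF this]
  have fe: "rGamma (1 / 4 - \<i> * w / 2) * zeta (1 / 2 + \<i> * w)
      = of_real pi powr (\<i> * w) * rGamma (1 / 4 + \<i> * w / 2) * zeta (1 / 2 - \<i> * w)"
  proof -
    have e: "(1 / 2 - \<i> * w) / 2 = 1 / 4 - \<i> * w / 2" "1 / 2 + \<i> * w - 1 / 2 = \<i> * w"
      "(1 / 2 + \<i> * w) / 2 = 1 / 4 + \<i> * w / 2" "1 - (1 / 2 + \<i> * w) = 1 / 2 - \<i> * w"
      by (simp_all add: field_simps)
    assume "rGamma ((1 - (1 / 2 + \<i> * w)) / 2) * zeta (1 / 2 + \<i> * w)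
      = of_real pi powr (1 / 2 + \<i> * w - 1 / 2) * rGamma ((1 / 2 + \<i> * w) / 2) * zeta (1 - (1 / 2 + \<i> * w))"
    then show ?thesis unfolding e .
  qed
  have "hardy_phase w ^ 2 * zeta (1 / 2 + \<i> * w)
      = of_real pi powr (- (\<i> * w)) * Gamma (1 / 4 + \<i> * w / 2) * (rGamma (1 / 4 - \<i> * w / 2) * zeta (1 / 2 + \<i> * w))"
    unfolding hardy_phase_square[OF w] by simp
  also have "\<dots> = (of_real pi powr (- (\<i> * w)) * of_real pi powr (\<i> * w))
       * (Gamma (1 / 4 + \<i> * w / 2) * rGamma (1 / 4 + \<i> * w / 2)) * zeta (1 / 2 - \<i> * w)"
    unfolding fe by simp
  also have "of_real pi powr (- (\<i> * w)) * of_real pi powr (\<i> * w) = 1"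
    by (simp flip: powr_add)
  finally have "hardy_phase w * (hardy_phase w * zeta (1 / 2 + \<i> * w)) = zeta (1 / 2 - \<i> * w)"
    unfolding G by (simp add: power2_eq_square mult.assoc)
  moreover have "hardy_phase w * cnj (hardy_phase z) = 1"
    unfolding w_def by (rule hardy_phase_cnj[OF z])
  moreover have "p * x = q * y" if "p * (p * x) = y" "p * q = 1" for p q x y :: complex
    unfolding that(1)[symmetric] using that(2) by (simp add: mult.commute[of q p] flip: mult.assoc)
  ultimately have "hardy_phase w * zeta (1 / 2 + \<i> * w) = cnj (hardy_phase z) * zeta (1 / 2 - \<i> * w)"
    by blast
  then show ?thesis
    by (simp add: hardy_ext_def w_def flip: zeta_cnj)
qed

text \<open>The phase is \<open>exp (\<i> * a)\<close> with \<open>a\<close> an argument of the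
  theta factor. Only exponentials are compared, so \<open>a\<close> need not be matched with the
  branch chosen for \<open>riemann_siegel_theta\<close>.\<close>

lemma hardy_phase_of_real:
  assumes t: "t \<noteq> 0"
  shows "hardy_phase (of_real t) = exp (\<i> * of_real (riemann_siegel_theta t))"
proof -
  define w where "w = ln_Gamma (1 / 4 + \<i> * of_real t / 2)"
  define a where "a = Im w - t / 2 * ln pi"
  have n: "1 / 4 + \<i> * of_real t / 2 \<notin> \<real>\<^sub>\<le>\<^sub>0" "1 / 4 + \<i> * of_real t / 2 \<notin> \<int>\<^sub>\<le>\<^sub>0"
    using hardy_arg_not_nonpos[of "of_real t"] t by auto
  have "ln_Gamma (1 / 4 - \<i> * of_real t / 2) = cnj w"
    unfolding w_def using n by (simp add: cnj_ln_Gamma)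
  then have "hardy_phase (of_real t) = exp (\<i> * of_real a)"
    unfolding hardy_phase_def w_def[symmetric] by (simp add: complex_diff_cnj a_def algebra_simps)
  moreover have factor: "riemann_siegel_theta_factor t = of_real (cmod (riemann_siegel_theta_factor t)) * exp (\<i> * of_real a)"
  proof -
    have "Gamma (1 / 4 + \<i> * of_real t / 2) = exp w" using n by (simp add: w_def Gamma_complex_altdef)
    moreover have "of_real pi powr (- (\<i> * of_real t / 2)) = exp (- (\<i> * of_real (t / 2 * ln pi)))"
      by (simp add: powr_def Ln_of_real mult_ac)
    ultimately have f: "riemann_siegel_theta_factor t = exp (w - \<i> * of_real (t / 2 * ln pi))"
      unfolding riemann_siegel_theta_factor_def by (simp only: mult_exp_exp) simp
    show ?thesis unfolding f norm_exp_eq_Re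
      by (subst exp_eq_polar) (simp add: a_def cis_conv_exp)
  qed
  moreover have "riemann_siegel_theta_factor t \<noteq> 0"
    using n by (auto simp: riemann_siegel_theta_factor_def Gamma_eq_zero_iff)
  ultimately show ?thesis
    using trans[OF factor[symmetric] riemann_siegel_theta_polar[of t]]
    unfolding mult_cancel_left of_real_eq_0_iff norm_eq_zero by (simp add: cis_conv_exp)
qed

lemma hardy_ext_of_real:
  assumes t: "t \<noteq> 0"
  shows "hardy_ext (of_real t) = of_real (hardy_Z t)"
proof -
  have "hardy_ext (of_real t) \<in> \<real>"
    using hardy_ext_cnj[of "of_real t"] t by (simp add: Reals_cnj_iff)
  moreover have "hardy_Z t = Re (hardy_ext (of_real t))"
    unfolding hardy_Z_def hardy_ext_def hardy_phase_of_real[OF t] ..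
  ultimately show ?thesis by (simp add: complex_is_Real_iff complex_eq_iff)
qed

lemma hardy_ext_holomorphic: "hardy_ext holomorphic_on {z. Re z > 0}"
proof -
  have "(\<lambda>z. ln_Gamma (1 / 4 + \<i> * z / 2)) holomorphic_on {z. Re z > 0}"
       "(\<lambda>z. ln_Gamma (1 / 4 - \<i> * z / 2)) holomorphic_on {z. Re z > 0}"
  proof -
    have "ln_Gamma holomorphic_on - \<real>\<^sub>\<le>\<^sub>0" by (rule holomorphic_ln_Gamma) auto
    note comp = holomorphic_on_compose_gen[OF _ this, unfolded o_def]
    show "(\<lambda>z. ln_Gamma (1 / 4 + \<i> * z / 2)) holomorphic_on {z. Re z > 0}"
      by (rule comp) (use hardy_arg_not_nonpos(1) in \<open>auto intro!: holomorphic_intros\<close>)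
    show "(\<lambda>z. ln_Gamma (1 / 4 - \<i> * z / 2)) holomorphic_on {z. Re z > 0}"
      by (rule comp) (use hardy_arg_not_nonpos(2) in \<open>auto intro!: holomorphic_intros\<close>)
  qed
  moreover have "(\<lambda>z. zeta (1 / 2 + \<i> * z)) holomorphic_on {z. Re z > 0}"
    by (rule holomorphic_on_compose_gen[OF _ zeta_holomorphic, unfolded o_def])
       (auto intro!: holomorphic_intros simp: complex_eq_iff)
  ultimately show ?thesis
    unfolding hardy_ext_def hardy_phase_def by (intro holomorphic_intros) auto
qed

text \<open>A holomorphic function that is real on the positive axis has a real derivative there,
  since its imaginary part is constantly \<open>0\<close> along the axis; induction gives all
  orders. The first claim yields the Taylor coefficients at \<open>T\<close>, the second serves the
  mean value theorem.\<close>

lemma higher_deriv_hardy_ext_of_real: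
  assumes "t > 0"
  shows "(deriv ^^ k) hardy_ext (of_real t) = of_real ((deriv ^^ k) hardy_Z t)"
    and "((deriv ^^ k) hardy_Z has_real_derivative (deriv ^^ Suc k) hardy_Z t) (at t)"
proof -
  have step: "((deriv ^^ k) hardy_Z has_real_derivative (deriv ^^ Suc k) hardy_Z t) (at t) \<and>
      (deriv ^^ Suc k) hardy_ext (of_real t) = of_real ((deriv ^^ Suc k) hardy_Z t)"
    if t: "t > 0" and eq: "\<And>t. t > 0 \<Longrightarrow> (deriv ^^ k) hardy_ext (of_real t) = of_real ((deriv ^^ k) hardy_Z t)" for k t
  proof -
    define G where "G = (deriv ^^ k) hardy_ext"
    define g where "g = (deriv ^^ k) hardy_Z"
    have op: "open {z. Re z > 0}" by (rule open_halfspace_Re_gt)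
    have "G holomorphic_on {z. Re z > 0}"
      unfolding G_def by (intro holomorphic_higher_deriv hardy_ext_holomorphic op)
    then have "(G has_field_derivative deriv G (of_real t)) (at (of_real t))"
      using t by (intro holomorphic_derivI[OF _ op]) auto
    then have 1: "((\<lambda>u. G (of_real u)) has_vector_derivative deriv G (of_real t)) (at t)"
      by (intro has_vector_derivative_real_field)
    have "((\<lambda>u. complex_of_real (g u)) has_vector_derivative deriv G (of_real t)) (at t)"
      using eq t by (intro has_vector_derivative_transform_within_open[OF 1, of "{0<..}"]) (auto simp: G_def g_def)
    then have d: "(g has_real_derivative Re (deriv G (of_real t))) (at t)"
         and "((\<lambda>u. 0) has_real_derivative Im (deriv G (of_real t))) (at t)"
      unfolding has_vector_derivative_complex_iff by simp_all
    from this(2) have "Im (deriv G (of_real t)) = 0"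
      by (rule DERIV_unique) (rule DERIV_const)
    then have d': "deriv G (of_real t) = of_real (Re (deriv G (of_real t)))"
      by (simp add: complex_eq_iff)
    from d have "deriv g t = Re (deriv G (of_real t))" by (intro DERIV_imp_deriv)
    with d d' show ?thesis unfolding funpow.simps o_def g_def[symmetric] G_def[symmetric] by simp
  qed
  have eq: "(deriv ^^ k) hardy_ext (of_real t) = of_real ((deriv ^^ k) hardy_Z t)" if "t > 0" for k t
    using that
  proof (induction k arbitrary: t)
    case 0 then show ?case using hardy_ext_of_real[of t] by simp
  next
    case (Suc k) then show ?case using step[of t k] by blast
  qed
  show "(deriv ^^ k) hardy_ext (of_real t) = of_real ((deriv ^^ k) hardy_Z t)" using assms by (rule eq)
  show "((deriv ^^ k) hardy_Z has_real_derivative (deriv ^^ Suc k) hardy_Z t) (at t)"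
    using step[OF assms eq] by blast
qed

section \<open>Size of the extension off the real axis\<close>

lemma norm_hardy_phase_square:
  assumes "\<tau> \<noteq> 0"
  shows "cmod (hardy_phase (Complex \<tau> (- v))) ^ 2
     = pi powr (- v) * cmod (Gamma (Complex (1 / 4 + v / 2) (\<tau> / 2))) * cmod (rGamma (Complex (1 / 4 - v / 2) (\<tau> / 2)))"
proof -
  define z where "z = Complex \<tau> (- v)"
  have e: "1 / 4 + \<i> * z / 2 = Complex (1 / 4 + v / 2) (\<tau> / 2)"
          "1 / 4 - \<i> * z / 2 = cnj (Complex (1 / 4 - v / 2) (\<tau> / 2))"
    by (simp_all add: z_def complex_eq_iff)
  have "cmod (of_real pi powr (- (\<i> * z))) = pi powr (- v)"
    by (subst norm_powr_real_powr) (auto simp: z_def)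
  moreover have "cmod (rGamma (cnj w)) = cmod (rGamma w)" for w :: complex
    by (simp flip: cnj_rGamma)
  ultimately show ?thesis
    using arg_cong[OF hardy_phase_square[of z], of cmod] assms
    unfolding e by (simp add: norm_mult norm_power z_def)
qed

text \<open>For integral \<open>n\<close> the arguments of the two Gamma factors (one of them
  conjugated) differ by \<open>n\<close>, so their quotient is a Pochhammer product of
  \<open>n\<close> factors with imaginary part \<open>T / 2\<close>. The zeta factor is evaluated at
  real part \<open>1 / 2 + n\<close>, where \<open>zeta_lower_bound\<close> applies.\<close>

lemma hardy_ext_lower_bound:
  assumes T: "T > 0" and n: "n \<ge> 3"
  shows "cmod (hardy_ext (Complex T (- real n))) \<ge> exp (real n * ln (sqrt (T / (2 * pi)))) / 4"
proof -
  define b where "b = Complex (1 / 4 - real n / 2) (T / 2)"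
  define L where "L = ln (sqrt (T / (2 * pi)))"
  have bn: "Complex (1 / 4 + real n / 2) (T / 2) = b + of_nat n" by (simp add: b_def complex_eq_iff)
  have nz: "b + of_nat n \<notin> \<int>\<^sub>\<le>\<^sub>0"
    using T by (auto simp: b_def complex_eq_iff elim!: nonpos_Ints_cases)
  have "cmod (hardy_phase (Complex T (- real n))) ^ 2
      = pi powr (- real n) * cmod (Gamma (b + of_nat n)) * cmod (pochhammer b n * rGamma (b + of_nat n))"
    using norm_hardy_phase_square[of T "real n"] T
    unfolding bn b_def[symmetric] pochhammer_rGamma[of b n, symmetric] by simp
  also have "\<dots> = cmod (pochhammer b n) / pi ^ n"
  proof -
    have "cmod (Gamma (b + of_nat n)) * cmod (rGamma (b + of_nat n)) = 1"
      using nz by (simp add: rGamma_inverse_Gamma norm_inverse Gamma_eq_zero_iff)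
    then have "cmod (Gamma (b + of_nat n)) * cmod (pochhammer b n * rGamma (b + of_nat n)) = cmod (pochhammer b n)"
      by (simp only: norm_mult mult.left_commute mult_1_right)
    moreover have "pi powr (- real n) = 1 / pi ^ n" by (simp add: powr_minus powr_realpow divide_inverse)
    ultimately show ?thesis by (simp add: mult.assoc)
  qed
  also have "cmod (pochhammer b n) \<ge> (T / 2) ^ n"
  proof -
    have "(T / 2) ^ n = (\<Prod>k<n. T / 2)" by simp
    also have "\<dots> \<le> (\<Prod>k<n. cmod (b + of_nat k))"
    proof (intro prod_mono conjI)
      fix k
      have "T / 2 = \<bar>Im (b + of_nat k)\<bar>" using T by (simp add: b_def)
      then show "T / 2 \<le> cmod (b + of_nat k)" using abs_Im_le_cmod by metis
    qed (use T in auto)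
    also have "\<dots> = cmod (pochhammer b n)" by (simp add: pochhammer_prod prod_norm atLeast0LessThan)
    finally show ?thesis .
  qed
  then have "cmod (pochhammer b n) / pi ^ n \<ge> (T / 2) ^ n / pi ^ n" by (intro divide_right_mono) auto
  also have "(T / 2) ^ n / pi ^ n = (T / (2 * pi)) ^ n" by (simp add: power_divide power_mult_distrib)
  also have "\<dots> = exp (real n * L) ^ 2"
  proof -
    have "T / (2 * pi) = exp L ^ 2" using T by (simp add: L_def)
    then show ?thesis by (simp only: exp_of_nat_mult power_mult[symmetric] mult.commute[of n 2])
  qed
  finally have "exp (real n * L) ^ 2 \<le> cmod (hardy_phase (Complex T (- real n))) ^ 2" .
  then have 1: "exp (real n * L) \<le> cmod (hardy_phase (Complex T (- real n)))"
    by (rule power2_le_imp_le) simp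
  have "1 / 2 + \<i> * Complex T (- real n) = Complex (1 / 2 + real n) T" by (simp add: complex_eq_iff)
  then have 2: "1 / 4 \<le> cmod (zeta (1 / 2 + \<i> * Complex T (- real n)))"
    using n by (simp only:) (intro zeta_lower_bound, simp)
  have "exp (real n * L) * (1 / 4) \<le> cmod (hardy_ext (Complex T (- real n)))"
    unfolding hardy_ext_def norm_mult by (intro mult_mono 1 2) auto
  then show ?thesis by (simp add: L_def)
qed

text \<open>For real \<open>v\<close> the Gamma arguments need not differ by an integer. The
  numerator is first enlarged, by the monotonicity lemmas, to Gamma at an integer shift of the
  denominator's argument; a Pochhammer product then remains.\<close>

lemma hardy_phase_upper_bound:
  assumes v: "0 \<le> v" "v \<le> real r" and \<tau>: "2 \<le> \<tau>"
  shows "cmod (hardy_phase (Complex \<tau> (- v))) \<le> (\<tau> + 2 * real r + 4) ^ (r + 3)"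
proof -
  define b where "b = Complex (1 / 4 - v / 2) (\<tau> / 2)"
  \<comment> \<open>The shift by \<open>v\<close> would give exactly the numerator; rounding up
    makes it integral, and the \<open>+ 2\<close> pays for
    \<open>norm_Gamma_le_plus_2\<close>.\<close>
  define N where "N = nat \<lceil>v\<rceil> + 2"
  define X where "X = \<tau> + 2 * real r + 4"
  have X: "X \<ge> 1" using \<tau> by (simp add: X_def)
  have N: "real N \<ge> v + 2" "N \<le> r + 3" using v unfolding N_def by linarith+
  have bN: "b + of_nat N = Complex (1 / 4 - v / 2 + real N) (\<tau> / 2)" by (simp add: b_def complex_eq_iff)
  have nz: "b + of_nat N \<notin> \<int>\<^sub>\<le>\<^sub>0"
    using \<tau> by (auto simp: b_def complex_eq_iff elim!: nonpos_Ints_cases)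
  have "cmod (Gamma (Complex (1 / 4 + v / 2) (\<tau> / 2))) \<le> cmod (Gamma (Complex (1 / 4 + v / 2 + 2) (\<tau> / 2)))"
    using \<tau> by (intro norm_Gamma_le_plus_2) auto
  also have "\<dots> \<le> cmod (Gamma (b + of_nat N))"
    unfolding bN using v N by (intro norm_Gamma_vertical_mono) auto
  finally have G: "cmod (Gamma (Complex (1 / 4 + v / 2) (\<tau> / 2))) \<le> cmod (Gamma (b + of_nat N))" .
  have "cmod (hardy_phase (Complex \<tau> (- v))) ^ 2
      = pi powr (- v) * cmod (Gamma (Complex (1 / 4 + v / 2) (\<tau> / 2))) * (cmod (pochhammer b N) * cmod (rGamma (b + of_nat N)))"
    using norm_hardy_phase_square[of \<tau> v] \<tau>
    unfolding b_def[symmetric] norm_mult[symmetric] pochhammer_rGamma[of b N, symmetric] by simp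
  also have "\<dots> \<le> 1 * cmod (Gamma (b + of_nat N)) * (cmod (pochhammer b N) * cmod (rGamma (b + of_nat N)))"
  proof (intro mult_mono G)
    have "pi powr (- v) \<le> pi powr 0" using v pi_ge_two by (intro powr_mono) auto
    then show "pi powr (- v) \<le> 1" by simp
  qed auto
  also have "\<dots> = cmod (pochhammer b N)"
    using nz by (simp add: rGamma_inverse_Gamma norm_inverse Gamma_eq_zero_iff)
  also have "\<dots> = (\<Prod>k<N. cmod (b + of_nat k))" by (simp add: pochhammer_prod prod_norm atLeast0LessThan)
  also have "\<dots> \<le> (\<Prod>k<N. X)"
  proof (intro prod_mono conjI)
    fix k assume "k \<in> {..<N}"
    then have k: "real k \<le> real r + 2" using N by simp
    have "cmod (b + of_nat k) \<le> \<bar>Re (b + of_nat k)\<bar> + \<bar>Im (b + of_nat k)\<bar>" by (rule cmod_le)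
    also have "\<dots> \<le> X" using k v \<tau> by (simp add: b_def X_def abs_if)
    finally show "cmod (b + of_nat k) \<le> X" .
  qed auto
  also have "\<dots> = X ^ N" by simp
  also have "\<dots> \<le> X ^ (r + 3)" using N X by (intro power_increasing) auto
  \<comment> \<open>The square root is given away: the exponent only has to be linear in
    \<open>r\<close>.\<close>
  also have "\<dots> \<le> (X ^ (r + 3)) ^ 2" using one_le_power[OF X, of "r + 3"] by (intro self_le_power) auto
  finally have "cmod (hardy_phase (Complex \<tau> (- v))) ^ 2 \<le> (X ^ (r + 3)) ^ 2" .
  then show ?thesis unfolding X_def[symmetric] by (rule power2_le_imp_le) (use X in auto)
qed

text \<open>Below the real axis \<open>1 / 2 + \<i> * z\<close> has real part at least
  \<open>1 / 2\<close>, so \<open>zeta_growth\<close> and the phase bound apply; the upper half of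
  the disc follows by \<open>hardy_ext_cnj\<close>. The condition on \<open>T\<close> keeps
  \<open>Re z \<ge> 2\<close>, away from the pole of \<open>zeta\<close>.\<close>

lemma hardy_ext_upper_bound:
  obtains c where "c > 0"
    "\<And>z T r. T \<ge> real r + 2 \<Longrightarrow> cmod (z - of_real T) \<le> real r \<Longrightarrow> cmod (hardy_ext z) \<le> c * (T + 3 * real r + 4) ^ (r + 4)"
proof -
  obtain c where c: "c > 0" "\<And>s. Re s \<ge> 1 / 2 \<Longrightarrow> cmod (s - 1) \<ge> 1 \<Longrightarrow> cmod (zeta s) \<le> c * cmod s"
    using zeta_growth by blast
  have lower: "cmod (hardy_ext z) \<le> c * (T + 3 * real r + 4) ^ (r + 4)"
    if T: "T \<ge> real r + 2" and z: "cmod (z - of_real T) \<le> real r" and Im: "Im z \<le> 0" for z T r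
  proof -
    define \<tau> v where "\<tau> = Re z" and "v = - Im z"
    have z_eq: "z = Complex \<tau> (- v)" by (simp add: \<tau>_def v_def)
    have \<tau>: "2 \<le> \<tau>" "\<tau> \<le> T + real r" using abs_Re_le_cmod[of "z - of_real T"] z T by (auto simp: \<tau>_def abs_if split: if_splits)
    have v: "0 \<le> v" "v \<le> real r" using abs_Im_le_cmod[of "z - of_real T"] z Im by (auto simp: v_def)
    define X where "X = T + 3 * real r + 4"
    have "1 / 2 + \<i> * z = Complex (1 / 2 + v) \<tau>" by (simp add: z_eq complex_eq_iff)
    moreover have "cmod (zeta (Complex (1 / 2 + v) \<tau>)) \<le> c * cmod (Complex (1 / 2 + v) \<tau>)"
    proof (rule c(2))
      show "1 \<le> cmod (Complex (1 / 2 + v) \<tau> - 1)"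
        using abs_Im_le_cmod[of "Complex (1 / 2 + v) \<tau> - 1"] \<tau> by simp
    qed (use v in auto)
    moreover have "cmod (Complex (1 / 2 + v) \<tau>) \<le> X"
      using cmod_le[of "Complex (1 / 2 + v) \<tau>"] v \<tau> by (simp add: X_def)
    ultimately have ze: "cmod (zeta (1 / 2 + \<i> * z)) \<le> c * X"
      using c(1) by (metis mult_le_cancel_left_pos order.trans)
    have "cmod (hardy_phase z) \<le> (\<tau> + 2 * real r + 4) ^ (r + 3)"
      unfolding z_eq by (rule hardy_phase_upper_bound[OF v \<tau>(1)])
    also have "\<dots> \<le> X ^ (r + 3)" using \<tau> by (intro power_mono) (auto simp: X_def)
    finally have "cmod (hardy_ext z) \<le> X ^ (r + 3) * (c * X)"
      unfolding hardy_ext_def norm_mult using ze \<tau> T by (intro mult_mono) (auto simp: X_def)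
    also have "\<dots> = c * X ^ (r + 4)" by (simp add: eval_nat_numeral)
    finally show ?thesis by (simp add: X_def)
  qed
  show ?thesis
  proof (rule that[OF c(1)])
    fix z T r assume T: "T \<ge> real r + 2" and z: "cmod (z - of_real T) \<le> real r"
    show "cmod (hardy_ext z) \<le> c * (T + 3 * real r + 4) ^ (r + 4)"
    proof (cases "Im z \<le> 0")
      case False
      have "Re z \<noteq> 0" using abs_Re_le_cmod[of "z - of_real T"] z T by auto
      then have "cmod (hardy_ext z) = cmod (hardy_ext (cnj z))" by (simp add: hardy_ext_cnj)
      moreover have "cmod (cnj z - of_real T) = cmod (z - of_real T)"
        by (metis complex_cnj_complex_of_real complex_cnj_diff complex_mod_cnj)
      ultimately show ?thesis using lower[of r T "cnj z"] False T z by simp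
    qed (use lower T z in auto)
  qed
qed

text \<open>At no more than half the radius, Cauchy's inequality bounds the \<open>k\<close>-th
  Taylor term by \<open>K / 2 ^ k\<close>, so the tail is dominated by a geometric series.\<close>

lemma holomorphic_taylor_tail_bound:
  assumes holo: "f holomorphic_on ball a \<rho>'" and \<rho>: "0 < \<rho>" "\<rho> < \<rho>'"
    and bound: "\<And>z. cmod (z - a) \<le> \<rho> \<Longrightarrow> cmod (f z) \<le> K"
    and w: "cmod (w - a) \<le> \<rho> / 2"
  shows "cmod (f w) \<le> (\<Sum>k<n. cmod ((deriv ^^ k) f a) / fact k * cmod (w - a) ^ k) + 2 * K * (1 / 2) ^ n"
proof -
  have K: "K \<ge> 0" using bound[of a] \<rho> by (smt (verit) norm_ge_zero norm_zero right_minus_eq)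
  define t where "t = (\<lambda>k. (deriv ^^ k) f a / fact k * (w - a) ^ k)"
  have "w \<in> ball a \<rho>'" using w \<rho> by (simp add: dist_norm norm_minus_commute)
  then have sums: "t sums f w" unfolding t_def by (rule holomorphic_power_series[OF holo])
  have le: "cmod (t k) \<le> K * (1 / 2) ^ k" for k
  proof -
    have "cmod ((deriv ^^ k) f a) \<le> fact k * K / \<rho> ^ k"
    proof (rule Cauchy_inequality)
      have "cball a \<rho> \<subseteq> ball a \<rho>'" using \<rho> by auto
      then show "continuous_on (cball a \<rho>) f" "f holomorphic_on ball a \<rho>"
        using holo \<rho> by (auto intro: holomorphic_on_imp_continuous_on holomorphic_on_subset)
    qed (use \<rho> bound in \<open>auto simp: norm_minus_commute\<close>)
    then have "cmod (t k) \<le> fact k * K / \<rho> ^ k / fact k * (\<rho> / 2) ^ k"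
      unfolding t_def norm_mult norm_divide norm_power norm_fact
      using w K \<rho> by (intro mult_mono divide_right_mono power_mono) auto
    also have "\<dots> = K * (1 / 2) ^ k" using \<rho> by (simp add: power_divide)
    finally show ?thesis .
  qed
  have geo: "(\<lambda>k. K * (1 / 2) ^ n * (1 / 2) ^ k) sums (K * (1 / 2) ^ n * 2)"
    using geometric_sums[of "1 / 2 :: real"] by (intro sums_mult) simp
  have "f w = (\<Sum>k. t (k + n)) + (\<Sum>k<n. t k)"
    using suminf_split_initial_segment[OF sums_summable[OF sums], of n] sums_unique[OF sums] by simp
  also have "cmod \<dots> \<le> cmod (\<Sum>k. t (k + n)) + cmod (\<Sum>k<n. t k)" by (rule norm_triangle_ineq)
  also have "cmod (\<Sum>k. t (k + n)) \<le> (\<Sum>k. K * (1 / 2) ^ n * (1 / 2) ^ k)"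
  proof (intro norm_suminf_le sums_summable[OF geo])
    show "cmod (t (k + n)) \<le> K * (1 / 2) ^ n * (1 / 2) ^ k" for k
      using le[of "k + n"] by (simp add: power_add mult_ac)
  qed
  also have "\<dots> = 2 * K * (1 / 2) ^ n" using sums_unique[OF geo] by simp
  also have "cmod (\<Sum>k<n. t k) \<le> (\<Sum>k<n. cmod (t k))" by (rule norm_sum)
  also have "\<dots> = (\<Sum>k<n. cmod ((deriv ^^ k) f a) / fact k * cmod (w - a) ^ k)"
    by (simp add: t_def norm_mult norm_divide norm_power)
  finally show ?thesis by simp
qed

subsection \<open>Large values of derivatives\<close>

lemma higher_deriv_hardy_Z_le_SUP:
  assumes "T > 2 * pi" and t: "t \<in> {T - 2 * pi..T + 2 * pi}"
  shows "\<bar>(deriv ^^ k) hardy_Z t\<bar> \<le> (SUP t\<in>{T - 2 * pi..T + 2 * pi}. \<bar>(deriv ^^ k) hardy_Z t\<bar>)"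
proof (rule cSUP_upper[OF t])
  have "continuous_on {T - 2 * pi..T + 2 * pi} ((deriv ^^ k) hardy_Z)"
    using assms by (intro continuous_at_imp_continuous_on ballI DERIV_isCont[OF higher_deriv_hardy_ext_of_real(2)]) auto
  then have "continuous_on {T - 2 * pi..T + 2 * pi} (\<lambda>t. \<bar>(deriv ^^ k) hardy_Z t\<bar>)"
    by (intro continuous_intros)
  then show "bdd_above ((\<lambda>t. \<bar>(deriv ^^ k) hardy_Z t\<bar>) ` {T - 2 * pi..T + 2 * pi})"
    by (intro compact_imp_bounded[THEN bounded_imp_bdd_above] compact_continuous_image) auto
qed

text \<open>On an interval of length \<open>1 / B\<close> the mean value theorem for
  \<open>f\<close> finds a point where \<open>g\<close> is at most \<open>2 * K\<close> in modulus,
  and the mean value theorem for \<open>g\<close> bounds the change back to \<open>a\<close> by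
  \<open>K\<close>.\<close>

lemma derivative_bound_from_neighbours:
  fixes f g h :: "real \<Rightarrow> real"
  assumes B: "B > 0"
    and fg: "\<And>t. t \<in> {a..a + 1 / B} \<Longrightarrow> (f has_real_derivative g t) (at t)"
    and gh: "\<And>t. t \<in> {a..a + 1 / B} \<Longrightarrow> (g has_real_derivative h t) (at t)"
    and f: "\<And>t. t \<in> {a..a + 1 / B} \<Longrightarrow> \<bar>f t\<bar> \<le> K / B"
    and h: "\<And>t. t \<in> {a..a + 1 / B} \<Longrightarrow> \<bar>h t\<bar> \<le> K * B"
  shows "\<bar>g a\<bar> \<le> 3 * K"
proof -
  have aB: "a < a + 1 / B" using B by simp
  obtain \<xi> where \<xi>: "a < \<xi>" "\<xi> < a + 1 / B" "f (a + 1 / B) - f a = (a + 1 / B - a) * g \<xi>"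
    using MVT2[OF aB, of f g] fg by auto
  obtain \<eta> where \<eta>: "a < \<eta>" "\<eta> < \<xi>" "g \<xi> - g a = (\<xi> - a) * h \<eta>"
    using MVT2[OF \<xi>(1), of g h] gh \<xi>(2) by auto
  have "\<bar>g \<xi>\<bar> = B * \<bar>f (a + 1 / B) - f a\<bar>"
    using \<xi>(3) B by (simp add: abs_mult)
  also have "\<dots> \<le> B * (K / B + K / B)"
    using f[of a] f[of "a + 1 / B"] aB B by (intro mult_left_mono) auto
  finally have 1: "\<bar>g \<xi>\<bar> \<le> 2 * K" using B by simp
  have "\<bar>(\<xi> - a) * h \<eta>\<bar> \<le> 1 / B * (K * B)"
    unfolding abs_mult using h[of \<eta>] \<xi> \<eta> B by (intro mult_mono) auto
  then have "\<bar>g \<xi> - g a\<bar> \<le> K" using \<eta>(3) B by simp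
  with 1 show ?thesis by linarith
qed

lemma exp_partial_sum_le:
  fixes x :: real
  assumes "x \<ge> 0"
  shows "(\<Sum>k<n. x ^ k / fact k) \<le> exp x"
proof -
  have "(\<lambda>k. x ^ k / fact k) sums exp x"
    using exp_converges[of x] by (simp add: divide_inverse mult.commute)
  then show ?thesis using assms by (metis (no_types, lifting) divide_nonneg_nonneg fact_ge_zero sum_le_suminf sums_iff finite_lessThan zero_le_power)
qed

lemma hardy_Z_ge_exp_of_derivative_bounds:
  fixes T B :: real and m n :: nat
  defines "L \<equiv> ln (sqrt (T / (2 * pi)))" and "M \<equiv> \<bar>hardy_Z T\<bar>"
  assumes B: "B \<ge> 1" and T: "T > 2 * pi" "T \<ge> 2 * real n + 2" and n: "n \<ge> 3"
    and deriv: "\<And>k t. odd k \<Longrightarrow> k < 2 * m \<Longrightarrow> t \<in> {T - 2 * pi..T + 2 * pi} \<Longrightarrow> \<bar>(deriv ^^ k) hardy_Z t\<bar> \<le> B ^ k * M"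
    and K: "\<And>z. cmod (z - of_real T) \<le> 2 * real n \<Longrightarrow> cmod (hardy_ext z) \<le> K"
    and tail: "16 * K \<le> 4 ^ m"
  shows "exp ((L - B) * real n) \<le> 24 * M"
proof -
  define w where "w = Complex T (- real n)"
  have wT: "cmod (w - of_real T) = real n" by (simp add: w_def cmod_def)
  have d: "\<bar>(deriv ^^ k) hardy_Z T\<bar> \<le> 3 * (B ^ k * M)" if k: "k < 2 * m" for k
  proof (cases "odd k")
    case True
    have "\<bar>(deriv ^^ k) hardy_Z T\<bar> \<le> B ^ k * M" using k True by (intro deriv) auto
    moreover have "0 \<le> B ^ k * M" using B by (simp add: M_def)
    ultimately show ?thesis by linarith
  next
    case even: False
    show ?thesis
    proof (cases "k = 0")
      case False
      then obtain j where j: "k = Suc j" by (cases k) auto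
      \<comment> \<open>An even \<open>k\<close> below \<open>2 * m\<close> is at most
        \<open>2 * m - 2\<close>, so both neighbouring orders are among the assumed ones.\<close>
      have jm: "odd j" "j < 2 * m" "odd (Suc k)" "Suc k < 2 * m" using even j k by presburger+
      have "1 / B \<le> 1" using B by simp
      also have "1 < 2 * pi" using pi_gt_zero pi_ge_two by linarith
      finally have sub: "{T..T + 1 / B} \<subseteq> {T - 2 * pi..T + 2 * pi}" by auto
      show ?thesis
      proof (rule derivative_bound_from_neighbours[of B T "(deriv ^^ j) hardy_Z" _ "(deriv ^^ Suc k) hardy_Z"])
        fix t assume t: "t \<in> {T..T + 1 / B}"
        then have t0: "t > 0" using T pi_gt_zero by (auto simp del: pi_gt_zero)
        show "((deriv ^^ j) hardy_Z has_real_derivative (deriv ^^ k) hardy_Z t) (at t)"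
          unfolding j by (rule higher_deriv_hardy_ext_of_real(2)[OF t0])
        show "((deriv ^^ k) hardy_Z has_real_derivative (deriv ^^ Suc k) hardy_Z t) (at t)"
          by (rule higher_deriv_hardy_ext_of_real(2)[OF t0])
        have tJ: "t \<in> {T - 2 * pi..T + 2 * pi}" using t sub by blast
        show "\<bar>(deriv ^^ j) hardy_Z t\<bar> \<le> (B ^ k * M) / B"
          using deriv[OF jm(1,2) tJ] B by (simp add: j)
        show "\<bar>(deriv ^^ Suc k) hardy_Z t\<bar> \<le> (B ^ k * M) * B"
          using deriv[OF jm(3,4) tJ] by (simp add: mult_ac)
      qed (use B in simp)
    qed (simp add: M_def)
  qed
  have "cmod (hardy_ext w) \<le> (\<Sum>k<2*m. cmod ((deriv ^^ k) hardy_ext (of_real T)) / fact k * cmod (w - of_real T) ^ k) + 2 * K * (1 / 2) ^ (2 * m)"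
  \<comment> \<open>The point \<open>w\<close> lies at exactly half the radius \<open>2 * n\<close>,
    and the disc of radius \<open>T\<close> about \<open>T\<close> stays in the right
    half-plane.\<close>
  proof (rule holomorphic_taylor_tail_bound[where \<rho> = "2 * real n" and \<rho>' = T])
    show "hardy_ext holomorphic_on ball (of_real T) T"
    proof (rule holomorphic_on_subset[OF hardy_ext_holomorphic], rule subsetI)
      fix z assume "z \<in> ball (complex_of_real T) T"
      then have "cmod (of_real T - z) < T" by (simp add: dist_norm)
      then show "z \<in> {z. Re z > 0}" using complex_Re_le_cmod[of "of_real T - z"] by simp
    qed
  qed (use n T K wT in auto)
  also have "(\<Sum>k<2*m. cmod ((deriv ^^ k) hardy_ext (of_real T)) / fact k * cmod (w - of_real T) ^ k)
      \<le> (\<Sum>k<2*m. 3 * M * ((B * real n) ^ k / fact k))"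
  proof (intro sum_mono)
    fix k assume "k \<in> {..<2*m}"
    then have "\<bar>(deriv ^^ k) hardy_Z T\<bar> \<le> 3 * (B ^ k * M)" by (intro d) auto
    moreover have "cmod ((deriv ^^ k) hardy_ext (of_real T)) = \<bar>(deriv ^^ k) hardy_Z T\<bar>"
      using T n by (subst higher_deriv_hardy_ext_of_real) auto
    ultimately have "cmod ((deriv ^^ k) hardy_ext (of_real T)) / fact k * cmod (w - of_real T) ^ k
        \<le> 3 * (B ^ k * M) / fact k * real n ^ k"
      unfolding wT by (intro mult_right_mono divide_right_mono) auto
    also have "\<dots> = 3 * M * ((B * real n) ^ k / fact k)" by (simp add: power_mult_distrib)
    finally show "cmod ((deriv ^^ k) hardy_ext (of_real T)) / fact k * cmod (w - of_real T) ^ k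
      \<le> 3 * M * ((B * real n) ^ k / fact k)" .
  qed
  also have "\<dots> = 3 * M * (\<Sum>k<2*m. (B * real n) ^ k / fact k)" by (simp add: sum_distrib_left)
  also have "\<dots> \<le> 3 * M * exp (B * real n)"
    using B by (intro mult_left_mono exp_partial_sum_le) (auto simp: M_def)
  also have "2 * K * (1 / 2) ^ (2 * m) \<le> 1 / 8"
  proof -
    have "(1 / 2 :: real) ^ (2 * m) = 1 / 4 ^ m" by (simp add: power_mult power_divide power2_eq_square)
    then show ?thesis using tail by (simp add: field_simps)
  qed
  finally have "cmod (hardy_ext w) \<le> 3 * M * exp (B * real n) + 1 / 8" by simp
  moreover have "exp (real n * L) / 4 \<le> cmod (hardy_ext w)"
    unfolding w_def L_def using T n by (intro hardy_ext_lower_bound) auto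
  \<comment> \<open>Hence the Taylor tail, at most \<open>1 / 8\<close>, uses up no more than half
    of the lower bound \<open>exp (n * L) / 4\<close>.\<close>
  moreover have "exp (real n * L) \<ge> 1"
    using T unfolding L_def by simp
  ultimately have "exp (real n * L) / 8 \<le> 3 * M * exp (B * real n)" by linarith
  then have "exp (real n * L) / exp (B * real n) \<le> 24 * M" by (simp add: field_simps)
  moreover have "exp ((L - B) * real n) = exp (real n * L) / exp (B * real n)"
    by (simp add: algebra_simps flip: exp_diff)
  ultimately show ?thesis by simp
qed

theorem theorem1p1:
  fixes C :: real
  assumes "riemann_hypothesis"
    and "C > inverse (2 * ln 2)"
  shows "\<forall>\<^sub>F T :: real in at_top.
    (let m = nat \<lfloor>C * ln T * ln (ln T)\<rfloor> in
      \<exists>k :: nat. (odd k \<and> 1 \<le> k \<and> k \<le> 2 * m - 1 \<or> k = 2 * m) \<and>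
        (SUP t\<in>{T - 2 * pi..T + 2 * pi}. \<bar>(deriv ^^ k) hardy_Z t\<bar>)
          \<ge> (1 - ln (ln (ln T)) / ln (ln T)) ^ k * (ln (sqrt (T / (2 * pi)))) ^ k * \<bar>hardy_Z T\<bar>)"
proof -
  have "0 < inverse (2 * ln (2 :: real))" by simp
  with assms(2) have C: "C > 0" by linarith
  obtain c where c: "c > 0"
    "\<And>z T r. T \<ge> real r + 2 \<Longrightarrow> cmod (z - of_real T) \<le> real r \<Longrightarrow> cmod (hardy_ext z) \<le> c * (T + 3 * real r + 4) ^ (r + 4)"
    using hardy_ext_upper_bound by metis
  have "\<forall>\<^sub>F T :: real in at_top. ln (ln T) > 0"
       "\<forall>\<^sub>F T :: real in at_top. ln (ln (ln T)) > 0"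
       "\<forall>\<^sub>F T :: real in at_top. 10 * ln (ln T) / ln (ln (ln T)) \<ge> 3"
       "\<forall>\<^sub>F T :: real in at_top. T \<ge> 2 * (10 * ln (ln T) / ln (ln (ln T)) + 1) + 2"
       "\<forall>\<^sub>F T :: real in at_top. T + 6 * (10 * ln (ln T) / ln (ln (ln T)) + 1) + 4 \<le> T\<^sup>2"
       "\<forall>\<^sub>F T :: real in at_top. (1 - ln (ln (ln T)) / ln (ln T)) * ln (sqrt (T / (2 * pi))) \<ge> 1"
       "\<forall>\<^sub>F T :: real in at_top. T > 2 * pi"
    by real_asymp+
  \<comment> \<open>This is the logarithm of the tail condition. The left side is of order
    \<open>ln T * ln (ln T) / ln (ln (ln T))\<close>, smaller than the right side; the
    \<open>- 1\<close> allows for the floor in \<open>m\<close>.\<close>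
  moreover have "\<forall>\<^sub>F T :: real in at_top. ln (16 * c) + (8 + 4 * (10 * ln (ln T) / ln (ln (ln T)) + 1)) * ln T
       \<le> ln 4 * (C * ln T * ln (ln T) - 1)"
    using C by real_asymp
  \<comment> \<open>The final contradiction: degree \<open>5\<close> comes from the factor
    \<open>10\<close> in the choice of \<open>n\<close>, degree \<open>4\<close> from the growth
    bound for Hardy's function at \<open>T\<close>.\<close>
  moreover have "\<forall>\<^sub>F T :: real in at_top. (T / (2 * pi)) ^ 5 > 24 * (c * (T + 4) ^ 4)"
    by real_asymp
  ultimately show ?thesis
  proof eventually_elim
    case (elim T)
    define L where "L = ln (sqrt (T / (2 * pi)))"
    define q where "q = ln (ln (ln T)) / ln (ln T)"
    define B where "B = (1 - q) * L"
    define m where "m = nat \<lfloor>C * ln T * ln (ln T)\<rfloor>"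
    define n where "n = nat \<lceil>10 * ln (ln T) / ln (ln (ln T))\<rceil>"
    define x where "x = 10 * ln (ln T) / ln (ln (ln T))"
    have n: "real n \<ge> x" "real n \<le> x + 1" "x \<ge> 3"
      using elim(3) unfolding n_def x_def[symmetric] by linarith+
    \<comment> \<open>The height \<open>n\<close> is chosen for this product:
      \<open>(L - B) * n = q * L * n\<close> is then at least \<open>10 * L\<close>.\<close>
    have q: "q * x = 10" using elim(1,2) by (simp add: q_def x_def)
    have T: "T > 2 * pi" "T > 1" "T \<ge> 2 * real n + 2" "T + 6 * real n + 4 \<le> T\<^sup>2"
      using elim(4,5,7) n pi_ge_two unfolding x_def[symmetric] by auto
    have L: "L \<ge> 0" using T by (simp add: L_def)
    \<comment> \<open>The growth bound with \<open>r = 2 * n\<close>, the radius used in the Taylor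
      expansion.\<close>
    have K: "cmod (hardy_ext z) \<le> c * (T + 6 * real n + 4) ^ (2 * n + 4)" if "cmod (z - of_real T) \<le> 2 * real n" for z
      using c(2)[of "2 * n" T z] that T by simp
    have tail: "16 * (c * (T + 6 * real n + 4) ^ (2 * n + 4)) \<le> 4 ^ m"
    proof -
      have "16 * (c * (T + 6 * real n + 4) ^ (2 * n + 4)) \<le> 16 * (c * (T\<^sup>2) ^ (2 * n + 4))"
        using T c(1) by (intro mult_left_mono power_mono) auto
      also have "\<dots> = exp (ln (16 * c) + real (4 * n + 8) * ln T)"
      proof -
        have "exp (real (4 * n + 8) * ln T) = T ^ (4 * n + 8)" using T by (simp only: exp_of_nat_mult) simp
        then show ?thesis using c(1) by (simp add: exp_add flip: power_mult)
      qed
      also have "ln (16 * c) + real (4 * n + 8) * ln T \<le> ln (16 * c) + (8 + 4 * (x + 1)) * ln T"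
        using n T by (intro add_left_mono mult_right_mono) auto
      also have "\<dots> \<le> ln 4 * (C * ln T * ln (ln T) - 1)" using elim(8) by (simp add: x_def)
      also have "\<dots> \<le> ln 4 * real m" unfolding m_def by (intro mult_left_mono) (linarith, simp)
      also have "exp (ln 4 * real m) = 4 ^ m" by (simp add: exp_of_nat2_mult)
      finally show ?thesis by simp
    qed
    have "\<exists>k. (odd k \<and> 1 \<le> k \<and> k \<le> 2 * m - 1 \<or> k = 2 * m) \<and>
        (SUP t\<in>{T - 2 * pi..T + 2 * pi}. \<bar>(deriv ^^ k) hardy_Z t\<bar>) \<ge> B ^ k * \<bar>hardy_Z T\<bar>"
    proof (rule ccontr)
      assume neg: "\<not> ?thesis"
      have "\<bar>(deriv ^^ k) hardy_Z t\<bar> \<le> B ^ k * \<bar>hardy_Z T\<bar>"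
        if k: "odd k" "k < 2 * m" and t: "t \<in> {T - 2 * pi..T + 2 * pi}" for k t
      proof -
        have "1 \<le> k" "k \<le> 2 * m - 1" using k by (auto elim: oddE)
        with neg k have "(SUP t\<in>{T - 2 * pi..T + 2 * pi}. \<bar>(deriv ^^ k) hardy_Z t\<bar>) < B ^ k * \<bar>hardy_Z T\<bar>"
          by (auto simp: not_le)
        with higher_deriv_hardy_Z_le_SUP[OF T(1) t, of k] show ?thesis by linarith
      qed
      then have "exp ((L - B) * real n) \<le> 24 * \<bar>hardy_Z T\<bar>"
        unfolding L_def using n elim(6)
        by (intro hardy_Z_ge_exp_of_derivative_bounds[OF _ T(1,3) _ _ K tail]) (auto simp: B_def q_def L_def)
      \<comment> \<open>The same growth bound with \<open>r = 0\<close>, where the disc shrinks to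
        the point \<open>T\<close>.\<close>
      also have "\<bar>hardy_Z T\<bar> \<le> c * (T + 4) ^ 4"
        using c(2)[of 0 T "of_real T"] T hardy_ext_of_real[of T] n by simp
      also have "24 * (c * (T + 4) ^ 4) < (T / (2 * pi)) ^ 5" by (rule elim(9))
      also have "\<dots> = exp (10 * L)"
      proof -
        have "T / (2 * pi) = exp L ^ 2" using T by (simp add: L_def)
        then have "(T / (2 * pi)) ^ 5 = exp L ^ 10" by (simp flip: power_mult)
        then show ?thesis by (simp flip: exp_of_nat_mult)
      qed
      also have "10 * L = q * x * L" by (simp add: q)
      also have "\<dots> \<le> q * real n * L"
        using n L elim(1,2) by (intro mult_right_mono mult_left_mono) (auto simp: q_def)
      also have "\<dots> = (L - B) * real n" by (simp add: B_def algebra_simps)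
      finally show False by simp
    qed
    then show ?case
      unfolding Let_def m_def[symmetric] by (simp add: B_def q_def L_def power_mult_distrib)
  qed
qed

end
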